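(* Let $\underline C=(C_1,\dots,C_d)$ be a coisometric tuple on a Hilbert space $\mathcal H_C$ and let $\underline E=(E_1,\dots,E_d)$ be a coisometric lifting of $\underline C$ on a Hilbert space $\mathcal H_E\supset\mathcal H_C$. Let $\Theta_{U,\tilde U}$ be the associated transfer function, $\Theta_{C,E}$ the (symbol of the) characteristic function of the lifting $\underline E$ of $\underline C$, and $\Psi_C,\Psi_E$ the unitaries defined in the context. Then $$\Psi_C\,\Theta_{U,\tilde U}(z)=\Theta_{C,E}\,\Psi_E$$ as operators from $\mathcal D_Ez^\emptyset$ to $\Gamma\otimes\mathcal D_C$, i.e. $\Psi_C\big(\Theta_{U,\tilde U}(z)(\eta z^\emptyset)\big)=\Theta_{C,E}(e_\emptyset\otimes\eta)$ for every $\eta\in\mathcal D_E$. In other words, the transfer function $\Theta_{U,\tilde U}$ coincides with the characteristic function $\Theta_{C,E}$.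
   Context: Let $d\ge 1$ be finite. For a tuple $\underline T=(T_1,\dots,T_d)$ of bounded operators on a Hilbert space $\mathcal L$: $\underline T$ is a row contraction if $\sum_j T_jT_j^*\le I$, and coisometric if $\sum_jT_jT_j^*=I$. For a row contraction, regarded as a row operator $\underline T:\bigoplus_1^d\mathcal L\to\mathcal L$, put $D_T=(I-\underline T^*\underline T)^{1/2}$ on $\bigoplus_1^d\mathcal L$, let $\mathcal D_T$ be the closure of the range of $D_T$, and let $(D_T)_j:\mathcal L\to\mathcal D_T$ be $(D_T)_j\ell=D_T(0,\dots,\ell,\dots,0)$ with $\ell$ in the $j$-th component; $(D_T)_j^*:\mathcal D_T\to\mathcal L$ is its adjoint. A coisometric tuple $\underline E$ on $\mathcal H_E\supset\mathcal H_C$ is a coisometric lifting of $\underline C$ if, with respect to $\mathcal H_E=\mathcal H_C\oplus\mathcal H_A$ (where $\mathcal H_A:=\mathcal H_C^\perp$), $E_j=\begin{pmatrix}C_j&0\\ B_j&A_j\end{pmatrix}$ for $j=1,\dots,d$. $\tilde\Lambda$ is the free semigroup (with empty word $\emptyset$) on $1,\dots,d$; $|\alpha|$ is the length of $\alpha$. For $\alpha=\alpha_1\cdots\alpha_n$, $T_\alpha=T_{\alpha_1}\cdots T_{\alpha_n}$, $T_\emptyset=I$, and $\bar\alpha=\alpha_n\cdots\alpha_1$ is the reversed word. $\Gamma=\bigoplus_{m\ge0}(\mathbb C^d)^{\otimes m}$ is the full Fock space with orthonormal basis $e_\alpha=e_{\alpha_1}\otimes\cdots\otimes e_{\alpha_m}$,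 and vacuum vector $e_\emptyset$. Let $z=(z_1,\dots,z_d)$ be formal non-commuting indeterminates, and $z^\alpha=z_{\alpha_n}\cdots z_{\alpha_1}$ for $\alpha=\alpha_n\cdots\alpha_1$; the $z$-variables commute with coefficients. For a Hilbert space $\mathcal V$, $\ell^2(\tilde\Lambda,\mathcal V)$ is the space of formal power series $g(z)=\sum_{\alpha\in\tilde\Lambda}g_\alpha z^\alpha$, $g_\alpha\in\mathcal V$, with $\|g\|^2=\sum_\alpha\|g_\alpha\|^2<\infty$. Transfer function. Let $P_{\mathcal H_C}$ be the orthogonal projection of $\mathcal H_E$ onto $\mathcal H_C$, and $$\tilde C=\sum_{j=1}^d(D_C)_jP_{\mathcal H_C}E_j^*:\mathcal H_E\to\mathcal D_C,\qquad \tilde D=\sum_{j=1}^d(D_C)_jP_{\mathcal H_C}(D_E)_j^*:\mathcal D_E\to\mathcal D_C.$$ The transfer function is the formal power series with coefficients in $\mathcal B(\mathcal D_E,\mathcal D_C)$ $$\Theta_{U,\tilde U}(z)=\tilde D+\tilde C\sum_{\beta\in\tilde\Lambda,\ j=1,\dots,d}(E_{\bar\beta})^*(D_E)_j^*\,z^{\beta j}.$$ It acts on $\mathcal D_Ez^\emptyset=\{\eta z^\emptyset:\eta\in\mathcal D_E\}\subset\ell^2(\tilde\Lambda,\mathcal D_E)$ by multiplication; multiplication by $\Theta_{U,\tilde U}$ is a contraction from $\ell^2(\tilde\Lambda,\mathcal D_E)$ to $\ell^2(\tilde\Lambda,\mathcal D_C)$. Unitaries. $\Psi_C:\ell^2(\tilde\Lambda,\mathcal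 D_C)\to\Gamma\otimes\mathcal D_C$, $\Psi_C\big(\sum_\alpha y_\alpha z^\alpha\big)=\sum_\alpha e_{\bar\alpha}\otimes y_\alpha$, and $\Psi_E:\mathcal D_Ez^\emptyset\to e_\emptyset\otimes\mathcal D_E$, $\Psi_E(\eta z^\emptyset)=e_\emptyset\otimes\eta$. Characteristic function of the lifting. Let $\underline A=(A_1,\dots,A_d)$, $\underline B=(B_1,\dots,B_d)$ be regarded as row operators, $D_{*,A}=(I-\underline A\,\underline A^* )^{1/2}:\mathcal H_A\to\mathcal H_A$, and $\mathcal D_{*,A}$ the closure of its range. There is an isometry $\gamma:\mathcal D_{*,A}\to\mathcal D_C$ with $\gamma D_{*,A}h=\underline B^*h$ for all $h\in\mathcal H_A$. The symbol $\Theta_{C,E}:e_\emptyset\otimes\mathcal D_E\to\Gamma\otimes\mathcal D_C$ of the characteristic function of the lifting $\underline E$ of $\underline C$ is the bounded operator determined, identifying $\mathcal D_E$ with $e_\emptyset\otimes\mathcal D_E$, by the following expansions for $i=1,\dots,d$: for $h\in\mathcal H_C$, $$\Theta_{C,E}(D_E)_ih=e_\emptyset\otimes[(D_C)_ih-\gamma D_{*,A}B_ih]-\sum_{|\alpha|\ge1}e_\alpha\otimes\gamma D_{*,A}(A_\alpha)^*B_ih,$$ and for $h\in\mathcal H_A$, $$\Theta_{C,E}(D_E)_ih=-e_\emptyset\otimes\gamma D_{*,A}A_ih+\sum_{j=1}^de_j\otimes\sum_{\alpha\in\tilde\Lambda}e_\alpha\otimes\gamma D_{*,A}(A_\alpha)^*(\delta_{ij}I-A_j^*A_i)h.$$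 *)

theory Defs
  imports "HOL-Analysis.Analysis"
begin

section \<open>Complex Hilbert spaces\<close>

text \<open>The inner product \<open>cinner\<close> is linear in its first argument.  Its real part is the real
  inner product of \<open>real_inner\<close>, so norm and topology are those of the library.\<close>

class complex_inner = real_inner +
  fixes scaleC :: "complex \<Rightarrow> 'a \<Rightarrow> 'a" (infixr "*\<^sub>C" 75)
    and cinner :: "'a \<Rightarrow> 'a \<Rightarrow> complex"
  assumes scaleC_add_right: "c *\<^sub>C (x + y) = c *\<^sub>C x + c *\<^sub>C y"
    and scaleC_add_left: "(b + c) *\<^sub>C x = b *\<^sub>C x + c *\<^sub>C x"
    and scaleC_scaleC: "b *\<^sub>C c *\<^sub>C x = (b * c) *\<^sub>C x"
    and scaleR_scaleC: "scaleR r x = complex_of_real r *\<^sub>C x"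
    and cinner_commute: "cinner x y = cnj (cinner y x)"
    and cinner_add_left: "cinner (x + y) z = cinner x z + cinner y z"
    and cinner_scaleC_left: "cinner (c *\<^sub>C x) y = c * cinner x y"
    and inner_eq_Re_cinner: "inner x y = Re (cinner x y)"

class chilbert_space = complex_inner + complete_space

lemma cinner_self: "cinner x x = complex_of_real ((norm x)\<^sup>2)" for x :: "'a::complex_inner"
proof -
  have "Im (cinner x x) = 0"
    using arg_cong[OF cinner_commute[of x x], of Im] by simp
  then show ?thesis
    unfolding complex_eq_iff power2_norm_eq_inner inner_eq_Re_cinner by simp
qed

lemma norm_scaleC: "norm (c *\<^sub>C x) = cmod c * norm x" for x :: "'a::complex_inner"
proof -
  have "cinner (c *\<^sub>C x) (c *\<^sub>C x) = c * cnj c * cinner x x"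
    using arg_cong[OF cinner_commute[of x x], of cnj]
    by (simp add: cinner_scaleC_left cinner_commute[of x "c *\<^sub>C x"])
  then have "complex_of_real ((norm (c *\<^sub>C x))\<^sup>2) = complex_of_real ((cmod c * norm x)\<^sup>2)"
    by (simp only: cinner_self complex_norm_square[symmetric] of_real_mult[symmetric]
        power_mult_distrib)
  then have "(norm (c *\<^sub>C x))\<^sup>2 = (cmod c * norm x)\<^sup>2"
    using of_real_eq_iff by blast
  then show ?thesis
    by (simp add: power2_eq_iff_nonneg)
qed

lemma scaleC_0_1: "0 *\<^sub>C x = 0" "1 *\<^sub>C x = x" for x :: "'v::complex_inner"
  using scaleR_scaleC[of 0 x] scaleR_scaleC[of 1 x] by simp_all

instantiation complex :: chilbert_space
begin

definition scaleC_complex :: "complex \<Rightarrow> complex \<Rightarrow> complex" where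
  "scaleC_complex c x = c * x"

definition cinner_complex :: "complex \<Rightarrow> complex \<Rightarrow> complex" where
  "cinner_complex x y = x * cnj y"

instance
proof
  fix r :: real and x y :: complex
  show "r *\<^sub>R x = complex_of_real r *\<^sub>C x"
    unfolding scaleC_complex_def by (rule scaleR_conv_of_real)
  show "inner x y = Re (cinner x y)"
    by (simp add: cinner_complex_def inner_complex_def)
qed (simp_all add: scaleC_complex_def cinner_complex_def distrib_left distrib_right mult.assoc)

end

text \<open>The finite direct sum \<open>\<Oplus>\<^sub>1\<^sup>d\<close> of copies of a Hilbert space; the library norm on vectors is
  the \<open>\<ell>\<^sup>2\<close> norm.\<close>

instantiation vec :: (complex_inner, finite) complex_inner
begin

definition scaleC_vec :: "complex \<Rightarrow> 'a ^ 'b \<Rightarrow> 'a ^ 'b" where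
  "scaleC_vec c x = (\<chi> i. c *\<^sub>C (x $ i))"

definition cinner_vec :: "'a ^ 'b \<Rightarrow> 'a ^ 'b \<Rightarrow> complex" where
  "cinner_vec x y = (\<Sum>i\<in>UNIV. cinner (x $ i) (y $ i))"

instance
proof
  fix b c :: complex and r :: real and x y z :: "'a ^ 'b"
  show "c *\<^sub>C (x + y) = c *\<^sub>C x + c *\<^sub>C y"
    by (simp add: vec_eq_iff scaleC_vec_def scaleC_add_right)
  show "(b + c) *\<^sub>C x = b *\<^sub>C x + c *\<^sub>C x"
    by (simp add: vec_eq_iff scaleC_vec_def scaleC_add_left)
  show "b *\<^sub>C c *\<^sub>C x = (b * c) *\<^sub>C x"
    by (simp add: vec_eq_iff scaleC_vec_def scaleC_scaleC)
  show "r *\<^sub>R x = complex_of_real r *\<^sub>C x"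
    by (simp add: vec_eq_iff scaleC_vec_def scaleR_scaleC)
  show "cinner x y = cnj (cinner y x)"
    unfolding cinner_vec_def cnj_sum by (intro sum.cong refl cinner_commute)
  show "cinner (x + y) z = cinner x z + cinner y z"
    by (simp add: cinner_vec_def cinner_add_left sum.distrib)
  show "cinner (c *\<^sub>C x) y = c * cinner x y"
    by (simp add: cinner_vec_def scaleC_vec_def cinner_scaleC_left sum_distrib_left)
  show "inner x y = Re (cinner x y)"
    by (simp add: cinner_vec_def inner_vec_def inner_eq_Re_cinner)
qed

end

instance vec :: (chilbert_space, finite) chilbert_space ..


section \<open>Square summable families\<close>

typedef (overloaded) ('i, 'v) l2 =
  "{f :: 'i \<Rightarrow> 'v::complex_inner. (\<lambda>i. (norm (f i))\<^sup>2) summable_on UNIV}"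
  morphisms coeff Abs_l2
  by (rule exI[of _ "\<lambda>_. 0"]) simp

setup_lifting type_definition_l2

lemma coeff_summable: "(\<lambda>i. (norm (coeff f i))\<^sup>2) summable_on UNIV"
  using coeff[of f] by simp

lemma sq_summable_add:
  fixes f g :: "'i \<Rightarrow> 'v::complex_inner"
  assumes "(\<lambda>i. (norm (f i))\<^sup>2) summable_on UNIV" "(\<lambda>i. (norm (g i))\<^sup>2) summable_on UNIV"
  shows "(\<lambda>i. (norm (f i + g i))\<^sup>2) summable_on UNIV"
proof (rule summable_on_comparison_test)
  show "(\<lambda>i. 2 * (norm (f i))\<^sup>2 + 2 * (norm (g i))\<^sup>2) summable_on UNIV"
    by (intro summable_on_add summable_on_cmult_right assms)
  fix i
  have "(norm (f i + g i))\<^sup>2 \<le> (norm (f i) + norm (g i))\<^sup>2"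
    by (intro power_mono norm_triangle_ineq norm_ge_zero)
  also have "\<dots> \<le> 2 * (norm (f i))\<^sup>2 + 2 * (norm (g i))\<^sup>2"
    using sum_squares_bound[of "norm (f i)" "norm (g i)"] by (simp add: power2_sum)
  finally show "(norm (f i + g i))\<^sup>2 \<le> 2 * (norm (f i))\<^sup>2 + 2 * (norm (g i))\<^sup>2" .
qed simp

lemma sq_summable_scaleC:
  fixes f :: "'i \<Rightarrow> 'v::complex_inner"
  assumes "(\<lambda>i. (norm (f i))\<^sup>2) summable_on UNIV"
  shows "(\<lambda>i. (norm (c *\<^sub>C f i))\<^sup>2) summable_on UNIV"
  using summable_on_cmult_right[OF assms, of "(cmod c)\<^sup>2"]
  by (simp add: norm_scaleC power_mult_distrib)

lemma norm_cinner_le: "cmod (cinner x y) \<le> (norm x)\<^sup>2 + (norm y)\<^sup>2"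
  for x y :: "'v::complex_inner"
proof -
  obtain c where c: "cmod c = 1" "c * cinner x y = complex_of_real (cmod (cinner x y))"
  proof (cases "cinner x y = 0")
    case True
    then show ?thesis using that[of 1] by simp
  next
    case False
    then show ?thesis
      by (intro that[of "complex_of_real (cmod (cinner x y)) / cinner x y"]) (simp_all add: norm_divide)
  qed
  have "cmod (cinner x y) = inner (c *\<^sub>C x) y"
    using c by (simp add: inner_eq_Re_cinner cinner_scaleC_left)
  also have "\<dots> \<le> norm (c *\<^sub>C x) * norm y"
    by (rule norm_cauchy_schwarz)
  also have "\<dots> = norm x * norm y"
    using c by (simp add: norm_scaleC)
  also have "\<dots> \<le> (norm x)\<^sup>2 + (norm y)\<^sup>2"
    using sum_squares_bound[of "norm x" "norm y"]
      mult_nonneg_nonneg[OF norm_ge_zero[of x] norm_ge_zero[of y]] by linarith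
  finally show ?thesis .
qed

lemma cinner_summable: "(\<lambda>i. cinner (coeff f i) (coeff g i)) summable_on UNIV"
proof (rule abs_summable_summable[OF summable_on_comparison_test])
  show "(\<lambda>i. (norm (coeff f i))\<^sup>2 + (norm (coeff g i))\<^sup>2) summable_on UNIV"
    by (intro summable_on_add coeff_summable)
qed (auto intro: norm_cinner_le)

lemma infsum_cinner_self: "(\<Sum>\<^sub>\<infinity>i. cinner (coeff f i) (coeff f i)) =
    complex_of_real (\<Sum>\<^sub>\<infinity>i. (norm (coeff f i))\<^sup>2)"
  unfolding cinner_self
  by (intro infsumI has_sum_bounded_linear[OF bounded_linear_of_real] has_sum_infsum coeff_summable)

instantiation l2 :: (type, complex_inner) complex_inner
begin

lift_definition zero_l2 :: "('a, 'b) l2" is "\<lambda>_. 0" by simp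

lift_definition plus_l2 :: "('a, 'b) l2 \<Rightarrow> ('a, 'b) l2 \<Rightarrow> ('a, 'b) l2"
  is "\<lambda>f g i. f i + g i" by (simp add: sq_summable_add)

lift_definition uminus_l2 :: "('a, 'b) l2 \<Rightarrow> ('a, 'b) l2" is "\<lambda>f i. - f i" by simp

definition minus_l2 :: "('a, 'b) l2 \<Rightarrow> ('a, 'b) l2 \<Rightarrow> ('a, 'b) l2" where
  "minus_l2 f g = f + - g"

lift_definition scaleC_l2 :: "complex \<Rightarrow> ('a, 'b) l2 \<Rightarrow> ('a, 'b) l2"
  is "\<lambda>c f i. c *\<^sub>C f i" by (simp add: sq_summable_scaleC)

definition scaleR_l2 :: "real \<Rightarrow> ('a, 'b) l2 \<Rightarrow> ('a, 'b) l2" where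
  "scaleR_l2 r f = complex_of_real r *\<^sub>C f"

definition cinner_l2 :: "('a, 'b) l2 \<Rightarrow> ('a, 'b) l2 \<Rightarrow> complex" where
  "cinner_l2 f g = (\<Sum>\<^sub>\<infinity>i. cinner (coeff f i) (coeff g i))"

definition inner_l2 :: "('a, 'b) l2 \<Rightarrow> ('a, 'b) l2 \<Rightarrow> real" where
  "inner_l2 f g = Re (cinner f g)"

definition norm_l2 :: "('a, 'b) l2 \<Rightarrow> real" where
  "norm_l2 f = sqrt (inner f f)"

definition dist_l2 :: "('a, 'b) l2 \<Rightarrow> ('a, 'b) l2 \<Rightarrow> real" where
  "dist_l2 f g = norm (f - g)"

definition sgn_l2 :: "('a, 'b) l2 \<Rightarrow> ('a, 'b) l2" where
  "sgn_l2 f = scaleR (inverse (norm f)) f"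

definition uniformity_l2 :: "(('a, 'b) l2 \<times> ('a, 'b) l2) filter" where
  "uniformity_l2 = (INF e\<in>{0 <..}. principal {(f, g). dist f g < e})"

definition open_l2 :: "('a, 'b) l2 set \<Rightarrow> bool" where
  "open_l2 U \<longleftrightarrow> (\<forall>x\<in>U. eventually (\<lambda>(x', y). x' = x \<longrightarrow> y \<in> U) uniformity)"

instance
proof
  fix f g h :: "('a, 'b) l2" and b c :: complex and r s :: real
  show "f + g + h = f + (g + h)" by transfer (simp add: add.assoc)
  show "f + g = g + f" by transfer (simp add: add.commute)
  show "0 + f = f" by transfer simp
  show "- f + f = 0" by transfer simp
  show "f - g = f + - g" by (rule minus_l2_def)
  show addr: "c *\<^sub>C (f + g) = c *\<^sub>C f + c *\<^sub>C g" for c :: complex and f g :: "('a, 'b) l2"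
    by transfer (simp add: scaleC_add_right)
  show addl: "(b + c) *\<^sub>C f = b *\<^sub>C f + c *\<^sub>C f" for b c
    by transfer (simp add: scaleC_add_left)
  show sc: "b *\<^sub>C c *\<^sub>C f = (b * c) *\<^sub>C f" for b c
    by transfer (simp add: scaleC_scaleC)
  show "r *\<^sub>R f = complex_of_real r *\<^sub>C f" by (rule scaleR_l2_def)
  show "r *\<^sub>R (f + g) = r *\<^sub>R f + r *\<^sub>R g" by (simp add: scaleR_l2_def addr)
  show "(r + s) *\<^sub>R f = r *\<^sub>R f + s *\<^sub>R f" by (simp add: scaleR_l2_def addl)
  show "r *\<^sub>R s *\<^sub>R f = (r * s) *\<^sub>R f" by (simp add: scaleR_l2_def sc)
  show "1 *\<^sub>R f = f"
    unfolding scaleR_l2_def of_real_1 by transfer (simp add: scaleC_0_1)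
  show "sgn f = scaleR (inverse (norm f)) f" by (rule sgn_l2_def)
  show "dist f g = norm (f - g)" by (rule dist_l2_def)
  show "uniformity = (INF e\<in>{0 <..}. principal {(f :: ('a, 'b) l2, g). dist f g < e})"
    by (rule uniformity_l2_def)
  show "open U \<longleftrightarrow> (\<forall>x\<in>U. eventually (\<lambda>(x', y). x' = x \<longrightarrow> y \<in> U) uniformity)"
    for U :: "('a, 'b) l2 set" by (rule open_l2_def)
  show comm: "cinner f g = cnj (cinner g f)" for f g :: "('a, 'b) l2"
    unfolding cinner_l2_def infsum_cnj[symmetric] by (intro infsum_cong cinner_commute)
  show add: "cinner (f + g) h = cinner f h + cinner g h"
    unfolding cinner_l2_def plus_l2.rep_eq cinner_add_left
    by (intro infsum_add cinner_summable)
  show scale: "cinner (c *\<^sub>C f) g = c * cinner f g" for c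
    unfolding cinner_l2_def scaleC_l2.rep_eq cinner_scaleC_left
    by (intro infsum_cmult_right cinner_summable)
  show "inner f g = Re (cinner f g)" by (rule inner_l2_def)
  show "inner f g = inner g f" unfolding inner_l2_def by (subst comm) simp
  show "inner (f + g) h = inner f h + inner g h" by (simp add: inner_l2_def add)
  show "inner (r *\<^sub>R f) g = r * inner f g" by (simp add: inner_l2_def scaleR_l2_def scale)
  have "cinner f f = complex_of_real (\<Sum>\<^sub>\<infinity>i. (norm (coeff f i))\<^sup>2)"
    unfolding cinner_l2_def by (rule infsum_cinner_self)
  then have eq: "inner f f = (\<Sum>\<^sub>\<infinity>i. (norm (coeff f i))\<^sup>2)"
    by (simp add: inner_l2_def)
  show "0 \<le> inner f f" unfolding eq by (intro infsum_nonneg) simp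
  show "inner f f = 0 \<longleftrightarrow> f = 0"
  proof
    assume "inner f f = 0"
    then have "coeff f i = 0" for i
      using nonneg_infsum_le_0D[of "\<lambda>i. (norm (coeff f i))\<^sup>2" UNIV i] coeff_summable[of f]
      by (simp add: eq)
    then show "f = 0" by transfer auto
  next
    assume "f = 0"
    then show "inner f f = 0" unfolding eq by (simp add: zero_l2.rep_eq)
  qed
  show "norm f = sqrt (inner f f)" by (rule norm_l2_def)
qed

end

lemma coeff_minus: "coeff (f - g) i = coeff f i - coeff g i"
  unfolding minus_l2_def plus_l2.rep_eq uminus_l2.rep_eq by simp

lemma norm_l2_sq: "(norm f)\<^sup>2 = (\<Sum>\<^sub>\<infinity>i. (norm (coeff f i))\<^sup>2)"
  for f :: "('i, 'v::complex_inner) l2"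
proof -
  have "complex_of_real ((norm f)\<^sup>2) = complex_of_real (\<Sum>\<^sub>\<infinity>i. (norm (coeff f i))\<^sup>2)"
    by (simp add: cinner_self[symmetric] cinner_l2_def infsum_cinner_self del: of_real_power)
  then show ?thesis using of_real_eq_iff by blast
qed

instance l2 :: (type, chilbert_space) chilbert_space
proof
  fix X :: "nat \<Rightarrow> ('a, 'b) l2"
  assume X: "Cauchy X"
  have sum_le: "(\<Sum>i\<in>F. (norm (coeff f i))\<^sup>2) \<le> (norm f)\<^sup>2" if "finite F"
    for F and f :: "('a, 'b) l2"
    unfolding norm_l2_sq by (rule finite_sum_le_infsum[OF coeff_summable that]) simp_all
  have minus: "coeff (f - g) i = coeff f i - coeff g i" for f g :: "('a, 'b) l2" and i
    by (rule coeff_minus)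
  have le: "norm (coeff f i) \<le> norm f" for f :: "('a, 'b) l2" and i
  proof (rule power2_le_imp_le)
    show "(norm (coeff f i))\<^sup>2 \<le> (norm f)\<^sup>2" using sum_le[of "{i}" f] by simp
  qed (rule norm_ge_zero)
  have "Cauchy (\<lambda>n. coeff (X n) i)" for i
  proof (rule metric_CauchyI)
    fix e :: real assume "e > 0"
    then obtain N where N: "\<forall>m\<ge>N. \<forall>n\<ge>N. dist (X m) (X n) < e"
      using metric_CauchyD[OF X \<open>e > 0\<close>] by blast
    have "dist (coeff (X m) i) (coeff (X n) i) \<le> dist (X m) (X n)" for m n
      using le[of "X m - X n" i] by (simp add: dist_norm minus)
    then show "\<exists>M. \<forall>m\<ge>M. \<forall>n\<ge>M. dist (coeff (X m) i) (coeff (X n) i) < e"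
      using N by (meson le_less_trans)
  qed
  then have "\<forall>i. \<exists>l. (\<lambda>n. coeff (X n) i) \<longlonglongrightarrow> l"
    by (simp add: Cauchy_convergent_iff convergent_def)
  then obtain f where f: "\<And>i. (\<lambda>n. coeff (X n) i) \<longlonglongrightarrow> f i"
    by metis
  have tail: "\<exists>N. \<forall>n\<ge>N. \<forall>F. finite F \<longrightarrow> (\<Sum>i\<in>F. (norm (coeff (X n) i - f i))\<^sup>2) \<le> e\<^sup>2"
    if "e > 0" for e :: real
  proof -
    obtain N where N: "\<And>m n. m \<ge> N \<Longrightarrow> n \<ge> N \<Longrightarrow> norm (X m - X n) < e"
      using metric_CauchyD[OF X \<open>e > 0\<close>] unfolding dist_norm by blast
    have "(\<Sum>i\<in>F. (norm (coeff (X n) i - f i))\<^sup>2) \<le> e\<^sup>2" if "n \<ge> N" "finite F" for n F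
    proof (rule LIMSEQ_le_const2)
      show "(\<lambda>m. \<Sum>i\<in>F. (norm (coeff (X n) i - coeff (X m) i))\<^sup>2)
          \<longlonglongrightarrow> (\<Sum>i\<in>F. (norm (coeff (X n) i - f i))\<^sup>2)"
        by (intro tendsto_intros f)
      have "(\<Sum>i\<in>F. (norm (coeff (X n) i - coeff (X m) i))\<^sup>2) \<le> e\<^sup>2" if "m \<ge> N" for m
      proof -
        have "(\<Sum>i\<in>F. (norm (coeff (X n) i - coeff (X m) i))\<^sup>2) \<le> (norm (X n - X m))\<^sup>2"
          using sum_le[OF \<open>finite F\<close>, of "X n - X m"] by (simp add: minus)
        also have "\<dots> \<le> e\<^sup>2"
          using N[OF \<open>n \<ge> N\<close> that] by (intro power_mono) auto
        finally show ?thesis .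
      qed
      then show "\<exists>N. \<forall>m\<ge>N. (\<Sum>i\<in>F. (norm (coeff (X n) i - coeff (X m) i))\<^sup>2) \<le> e\<^sup>2"
        by blast
    qed
    then show ?thesis by blast
  qed
  have summ: "(\<lambda>i. (norm (coeff (X n) i - f i))\<^sup>2) summable_on UNIV"
    and infs: "(\<Sum>\<^sub>\<infinity>i. (norm (coeff (X n) i - f i))\<^sup>2) \<le> e\<^sup>2"
    if *: "\<And>F. finite F \<Longrightarrow> (\<Sum>i\<in>F. (norm (coeff (X n) i - f i))\<^sup>2) \<le> e\<^sup>2" for n and e :: real
  proof -
    show "(\<lambda>i. (norm (coeff (X n) i - f i))\<^sup>2) summable_on UNIV"
      by (rule nonneg_bdd_above_summable_on) (auto intro!: bdd_aboveI2[where M = "e\<^sup>2"] *)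
    then show "(\<Sum>\<^sub>\<infinity>i. (norm (coeff (X n) i - f i))\<^sup>2) \<le> e\<^sup>2"
      by (rule infsum_le_finite_sums) (use * in auto)
  qed
  obtain N where N: "\<And>F. finite F \<Longrightarrow> (\<Sum>i\<in>F. (norm (coeff (X N) i - f i))\<^sup>2) \<le> 1\<^sup>2"
    using tail[OF zero_less_one] by blast
  have "(\<lambda>i. (norm (coeff (X N) i + - (coeff (X N) i - f i)))\<^sup>2) summable_on UNIV"
    by (rule sq_summable_add[OF coeff_summable]) (use summ[OF N] in \<open>simp only: norm_minus_cancel\<close>)
  then have f_l2: "coeff (Abs_l2 f) = f"
    by (simp add: Abs_l2_inverse)
  have "X \<longlonglongrightarrow> Abs_l2 f"
  proof (rule metric_LIMSEQ_I)
    fix r :: real assume "r > 0"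
    then obtain N where N: "\<And>n F. n \<ge> N \<Longrightarrow> finite F \<Longrightarrow>
        (\<Sum>i\<in>F. (norm (coeff (X n) i - f i))\<^sup>2) \<le> (r / 2)\<^sup>2"
      using tail[OF half_gt_zero[OF \<open>r > 0\<close>]] by blast
    have "dist (X n) (Abs_l2 f) < r" if "n \<ge> N" for n
    proof -
      have "(norm (X n - Abs_l2 f))\<^sup>2 \<le> (r / 2)\<^sup>2"
        unfolding norm_l2_sq minus f_l2 using N[OF that] by (rule infs)
      then have "norm (X n - Abs_l2 f) \<le> r / 2"
        by (rule power2_le_imp_le) (use \<open>r > 0\<close> in simp)
      then show ?thesis using \<open>r > 0\<close> by (simp add: dist_norm)
    qed
    then show "\<exists>N. \<forall>n\<ge>N. dist (X n) (Abs_l2 f) < r" by blast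
  qed
  then show "convergent X" by (auto simp: convergent_def)
qed


section \<open>Operators between closed subspaces\<close>

text \<open>Hilbert spaces which occur as subspaces of another one are closed subspaces of a type of
  class \<open>chilbert_space\<close>.  An operator \<open>X \<rightarrow> Y\<close> between such subspaces is a function of which only
  the values on \<open>X\<close> matter.\<close>

definition closed_csubspace :: "'a::chilbert_space set \<Rightarrow> bool" where
  "closed_csubspace X \<longleftrightarrow> closed X \<and> 0 \<in> X \<and> (\<forall>x\<in>X. \<forall>y\<in>X. x + y \<in> X) \<and> (\<forall>c. \<forall>x\<in>X. c *\<^sub>C x \<in> X)"

definition orth :: "'a::chilbert_space set \<Rightarrow> 'a set" where
  "orth X = {y. \<forall>x\<in>X. cinner y x = 0}"

definition proj :: "'a::chilbert_space set \<Rightarrow> 'a \<Rightarrow> 'a" where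
  "proj X y = (THE p. p \<in> X \<and> y - p \<in> orth X)"

definition bounded_op ::
    "'a::chilbert_space set \<Rightarrow> 'b::chilbert_space set \<Rightarrow> ('a \<Rightarrow> 'b) \<Rightarrow> bool" where
  "bounded_op X Y T \<longleftrightarrow>
     (\<forall>x\<in>X. T x \<in> Y) \<and>
     (\<forall>x\<in>X. \<forall>y\<in>X. T (x + y) = T x + T y) \<and>
     (\<forall>c. \<forall>x\<in>X. T (c *\<^sub>C x) = c *\<^sub>C T x) \<and>
     (\<exists>K. \<forall>x\<in>X. norm (T x) \<le> K * norm x)"

definition isometry_op ::
    "'a::chilbert_space set \<Rightarrow> 'b::chilbert_space set \<Rightarrow> ('a \<Rightarrow> 'b) \<Rightarrow> bool" where
  "isometry_op X Y T \<longleftrightarrow> bounded_op X Y T \<and> (\<forall>x\<in>X. norm (T x) = norm x)"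

text \<open>The adjoint \<open>Y \<rightarrow> X\<close> of an operator \<open>T : X \<rightarrow> Y\<close>.\<close>

definition adj ::
    "'a::chilbert_space set \<Rightarrow> 'b::chilbert_space set \<Rightarrow> ('a \<Rightarrow> 'b) \<Rightarrow> 'b \<Rightarrow> 'a" where
  "adj X Y T y = (THE x. x \<in> X \<and> (\<forall>u\<in>X. cinner (T u) y = cinner u x))"

text \<open>The positive square root of a positive operator on \<open>X\<close>.  Setting it to \<open>0\<close> off \<open>X\<close> makes it
  unique as a function on the whole type.\<close>

definition psqrt :: "'a::chilbert_space set \<Rightarrow> ('a \<Rightarrow> 'a) \<Rightarrow> 'a \<Rightarrow> 'a" where
  "psqrt X P = (THE S. bounded_op X X S \<and> (\<forall>x\<in>X. cinner (S x) x \<in> \<real>\<^sub>\<ge>\<^sub>0) \<and>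
     (\<forall>x\<in>X. S (S x) = P x) \<and> (\<forall>x. x \<notin> X \<longrightarrow> S x = 0))"


section \<open>Operator tuples\<close>

text \<open>The index type \<open>'n\<close> plays the role of \<open>{1,\<dots>,d}\<close>; words in \<open>1,\<dots>,d\<close> are lists over \<open>'n\<close>.\<close>

definition dsum :: "'h::chilbert_space set \<Rightarrow> ('h ^ 'n::finite) set" where
  "dsum X = {x. \<forall>j. x $ j \<in> X}"

definition row :: "('n::finite \<Rightarrow> 'h::chilbert_space \<Rightarrow> 'h) \<Rightarrow> 'h ^ 'n \<Rightarrow> 'h" where
  "row T x = (\<Sum>j\<in>UNIV. T j (x $ j))"

primrec word_op :: "('n \<Rightarrow> 'h \<Rightarrow> 'h) \<Rightarrow> 'n list \<Rightarrow> 'h \<Rightarrow> 'h" where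
  "word_op T [] = id"
| "word_op T (j # \<alpha>) = T j \<circ> word_op T \<alpha>"

definition coisometric :: "'h::chilbert_space set \<Rightarrow> ('n::finite \<Rightarrow> 'h \<Rightarrow> 'h) \<Rightarrow> bool" where
  "coisometric X T \<longleftrightarrow>
     (\<forall>j. bounded_op X X (T j)) \<and> (\<forall>x\<in>X. (\<Sum>j\<in>UNIV. T j (adj X X (T j) x)) = x)"

definition defect_op ::
    "'h::chilbert_space set \<Rightarrow> ('n::finite \<Rightarrow> 'h \<Rightarrow> 'h) \<Rightarrow> 'h ^ 'n \<Rightarrow> 'h ^ 'n" where
  "defect_op X T = psqrt (dsum X) (\<lambda>x. x - adj (dsum X) X (row T) (row T x))"

definition defect_space ::
    "'h::chilbert_space set \<Rightarrow> ('n::finite \<Rightarrow> 'h \<Rightarrow> 'h) \<Rightarrow> ('h ^ 'n) set" where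
  "defect_space X T = closure (defect_op X T ` dsum X)"

definition defect_comp ::
    "'h::chilbert_space set \<Rightarrow> ('n::finite \<Rightarrow> 'h \<Rightarrow> 'h) \<Rightarrow> 'n \<Rightarrow> 'h \<Rightarrow> 'h ^ 'n" where
  "defect_comp X T j l = defect_op X T (axis j l)"

definition defect_comp_adj ::
    "'h::chilbert_space set \<Rightarrow> ('n::finite \<Rightarrow> 'h \<Rightarrow> 'h) \<Rightarrow> 'n \<Rightarrow> 'h ^ 'n \<Rightarrow> 'h" where
  "defect_comp_adj X T j = adj X (defect_space X T) (defect_comp X T j)"

definition star_defect_op ::
    "'h::chilbert_space set \<Rightarrow> ('n::finite \<Rightarrow> 'h \<Rightarrow> 'h) \<Rightarrow> 'h \<Rightarrow> 'h" where
  "star_defect_op X T = psqrt X (\<lambda>x. x - row T (adj (dsum X) X (row T) x))"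

definition star_defect_space ::
    "'h::chilbert_space set \<Rightarrow> ('n::finite \<Rightarrow> 'h \<Rightarrow> 'h) \<Rightarrow> 'h set" where
  "star_defect_space X T = closure (star_defect_op X T ` X)"


section \<open>Coisometric liftings\<close>

text \<open>The space \<open>\<H>\<^sub>E\<close> is the whole type, \<open>\<H>\<^sub>A\<close> is \<open>orth HC\<close>.  The tuples \<open>A\<close> and \<open>B\<close> are the
  entries of the block matrices of \<open>E\<close>.\<close>

definition coisometric_lifting ::
    "'h::chilbert_space set \<Rightarrow> ('n::finite \<Rightarrow> 'h \<Rightarrow> 'h) \<Rightarrow> ('n \<Rightarrow> 'h \<Rightarrow> 'h) \<Rightarrow>
     ('n \<Rightarrow> 'h \<Rightarrow> 'h) \<Rightarrow> ('n \<Rightarrow> 'h \<Rightarrow> 'h) \<Rightarrow> bool" where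
  "coisometric_lifting HC C E A B \<longleftrightarrow>
     coisometric UNIV E \<and>
     (\<forall>j. \<forall>h\<in>HC. C j h \<in> HC \<and> B j h \<in> orth HC \<and> E j h = C j h + B j h) \<and>
     (\<forall>j. \<forall>h\<in>orth HC. A j h \<in> orth HC \<and> E j h = A j h)"

definition lifting_isometry ::
    "'h::chilbert_space set \<Rightarrow> ('n::finite \<Rightarrow> 'h \<Rightarrow> 'h) \<Rightarrow> ('n \<Rightarrow> 'h \<Rightarrow> 'h) \<Rightarrow>
     ('n \<Rightarrow> 'h \<Rightarrow> 'h) \<Rightarrow> ('h \<Rightarrow> 'h ^ 'n) \<Rightarrow> bool" where
  "lifting_isometry HC C A B \<gamma> \<longleftrightarrow>
     isometry_op (star_defect_space (orth HC) A) (defect_space HC C) \<gamma> \<and>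
     (\<forall>h\<in>orth HC. \<gamma> (star_defect_op (orth HC) A h) = adj (dsum HC) (orth HC) (row B) h)"


section \<open>Formal power series and the full Fock space\<close>

text \<open>The space \<open>\<ell>\<^sup>2(\<Lambda>, V)\<close> of formal power series: \<open>coeff g \<alpha>\<close> is the coefficient of \<open>g\<close> at
  \<open>z\<^sup>\<alpha>\<close>, and \<open>z\<^sup>\<alpha> z\<^sup>\<beta> = z\<^sup>(\<alpha> @ \<beta>)\<close>.  Formal power series with operator coefficients are functions
  on words.\<close>

definition l2_in :: "'v::complex_inner set \<Rightarrow> ('i, 'v) l2 set" where
  "l2_in V = {g. \<forall>\<alpha>. coeff g \<alpha> \<in> V}"

definition const_series :: "'v::complex_inner \<Rightarrow> ('n list, 'v) l2" where
  "const_series \<eta> = Abs_l2 (\<lambda>\<alpha>. if \<alpha> = [] then \<eta> else 0)"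

definition series_mult ::
    "('n list \<Rightarrow> 'v \<Rightarrow> 'w) \<Rightarrow> ('n list, 'v::complex_inner) l2 \<Rightarrow> ('n list, 'w::complex_inner) l2" where
  "series_mult \<Theta> g = Abs_l2 (\<lambda>\<alpha>. \<Sum>(\<beta>, \<beta>')\<in>{(\<beta>, \<beta>'). \<beta> @ \<beta>' = \<alpha>}. \<Theta> \<beta> (coeff g \<beta>'))"

text \<open>The full Fock space \<open>\<Gamma>\<close> with its orthonormal basis \<open>e\<^sub>\<alpha>\<close>, for which
  \<open>e\<^sub>\<alpha> \<otimes> e\<^sub>\<beta> = e\<^sub>\<alpha>\<^sub>\<beta>\<close>.  The Hilbert space tensor product \<open>\<Gamma> \<otimes> V\<close> is realised as the space of
  square summable families \<open>'n list \<rightarrow> V\<close> with \<open>(f \<otimes> y)\<^sub>\<alpha> = f\<^sub>\<alpha> y\<close>; the lemmas below show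
  that this is a model of the tensor product.\<close>

type_synonym 'n fock = "('n list, complex) l2"

definition fock_basis :: "'n list \<Rightarrow> 'n fock" where
  "fock_basis \<alpha> = Abs_l2 (\<lambda>\<beta>. if \<beta> = \<alpha> then 1 else 0)"

definition tensor :: "'n fock \<Rightarrow> 'v::complex_inner \<Rightarrow> ('n list, 'v) l2" (infixr "\<otimes>\<^sub>F" 72) where
  "f \<otimes>\<^sub>F y = Abs_l2 (\<lambda>\<alpha>. coeff f \<alpha> *\<^sub>C y)"

lemma summable_single: "(\<lambda>\<beta>. (norm (if \<beta> = \<alpha> then x else 0))\<^sup>2) summable_on UNIV"
  for x :: "'v::complex_inner"
  by (rule summable_on_cong_neutral[where S = "{\<alpha>}", THEN iffD1]) auto

lemma coeff_const_series: "coeff (const_series \<eta>) \<alpha> = (if \<alpha> = [] then \<eta> else 0)"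
  unfolding const_series_def using summable_single[of "[]" \<eta>] by (subst Abs_l2_inverse) auto

lemma coeff_fock_basis: "coeff (fock_basis \<alpha>) \<beta> = (if \<beta> = \<alpha> then 1 else 0)"
  unfolding fock_basis_def using summable_single[of \<alpha> "1::complex"] by (subst Abs_l2_inverse) auto

lemma coeff_tensor: "coeff (f \<otimes>\<^sub>F y) \<alpha> = coeff f \<alpha> *\<^sub>C y"
proof -
  have "(\<lambda>\<alpha>. (norm (coeff f \<alpha> *\<^sub>C y))\<^sup>2) summable_on UNIV"
    using summable_on_cmult_left[OF coeff_summable[of f], of "(norm y)\<^sup>2"]
    by (simp add: norm_scaleC power_mult_distrib)
  then show ?thesis by (simp add: tensor_def Abs_l2_inverse)
qed

lemma cinner_tensor: "cinner (f \<otimes>\<^sub>F x) (g \<otimes>\<^sub>F y) = cinner f g * cinner x y"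
proof -
  have "cinner (a *\<^sub>C x) (b *\<^sub>C y) = cinner a b * cinner x y" for a b :: complex
    using arg_cong[OF cinner_commute[of y x], of cnj]
    by (simp add: cinner_scaleC_left cinner_complex_def cinner_commute[of x "b *\<^sub>C y"])
  then show ?thesis
    unfolding cinner_l2_def coeff_tensor by (simp add: infsum_cmult_left cinner_summable)
qed

lemma tensor_expansion: "((\<lambda>\<alpha>. fock_basis \<alpha> \<otimes>\<^sub>F coeff f \<alpha>) has_sum f) UNIV"
  for f :: "('n list, 'v::complex_inner) l2"
proof -
  define S where "S = (\<lambda>F. \<Sum>\<alpha>\<in>F. fock_basis \<alpha> \<otimes>\<^sub>F coeff f \<alpha>)"
  have coeff_S: "coeff (S F) \<beta> = (if \<beta> \<in> F then coeff f \<beta> else 0)" if "finite F" for F \<beta>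
    using that unfolding S_def
    by (induction F) (auto simp: zero_l2.rep_eq plus_l2.rep_eq coeff_tensor coeff_fock_basis scaleC_0_1)
  let ?q = "\<lambda>\<alpha>. (norm (coeff f \<alpha>))\<^sup>2"
  have eq: "(norm (f - S F))\<^sup>2 = infsum ?q UNIV - sum ?q F" if "finite F" for F
  proof -
    have "(norm (f - S F))\<^sup>2 = infsum ?q (UNIV - F)"
      unfolding norm_l2_sq
      by (rule infsum_cong_neutral)
        (auto simp: coeff_minus coeff_S[OF that])
    also have "\<dots> = infsum ?q UNIV - infsum ?q F"
      using that by (intro infsum_Diff coeff_summable) auto
    finally show ?thesis using that by simp
  qed
  have "((\<lambda>F. infsum ?q UNIV - sum ?q F) \<longlongrightarrow> infsum ?q UNIV - infsum ?q UNIV) (finite_subsets_at_top UNIV)"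
    using infsum_tendsto[OF coeff_summable[of f]] by (intro tendsto_intros)
  moreover have "\<forall>\<^sub>F F in finite_subsets_at_top UNIV. infsum ?q UNIV - sum ?q F = (norm (f - S F))\<^sup>2"
    by (rule eventually_finite_subsets_at_top_weakI) (simp add: eq)
  ultimately have "((\<lambda>F. (norm (f - S F))\<^sup>2) \<longlongrightarrow> infsum ?q UNIV - infsum ?q UNIV) (finite_subsets_at_top UNIV)"
    by (rule Lim_transform_eventually)
  then have "((\<lambda>F. sqrt ((norm (f - S F))\<^sup>2)) \<longlongrightarrow> sqrt (infsum ?q UNIV - infsum ?q UNIV)) (finite_subsets_at_top UNIV)"
    by (rule tendsto_real_sqrt)
  then have "((\<lambda>F. dist (S F) f) \<longlongrightarrow> 0) (finite_subsets_at_top UNIV)"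
    by (simp add: dist_norm norm_minus_commute)
  then show ?thesis
    unfolding has_sum_def S_def[symmetric] by (rule iffD2[OF tendsto_dist_iff])
qed


section \<open>Transfer function and characteristic function\<close>

definition tilde_C ::
    "'h::chilbert_space set \<Rightarrow> ('n::finite \<Rightarrow> 'h \<Rightarrow> 'h) \<Rightarrow> ('n \<Rightarrow> 'h \<Rightarrow> 'h) \<Rightarrow> 'h \<Rightarrow> 'h ^ 'n" where
  "tilde_C HC C E x = (\<Sum>j\<in>UNIV. defect_comp HC C j (proj HC (adj UNIV UNIV (E j) x)))"

definition tilde_D ::
    "'h::chilbert_space set \<Rightarrow> ('n::finite \<Rightarrow> 'h \<Rightarrow> 'h) \<Rightarrow> ('n \<Rightarrow> 'h \<Rightarrow> 'h) \<Rightarrow> 'h ^ 'n \<Rightarrow> 'h ^ 'n" where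
  "tilde_D HC C E \<eta> = (\<Sum>j\<in>UNIV. defect_comp HC C j (proj HC (defect_comp_adj UNIV E j \<eta>)))"

text \<open>The coefficient of the transfer function at \<open>z\<^sup>\<alpha>\<close>; the inner sum has at most one term.\<close>

definition transfer_function ::
    "'h::chilbert_space set \<Rightarrow> ('n::finite \<Rightarrow> 'h \<Rightarrow> 'h) \<Rightarrow> ('n \<Rightarrow> 'h \<Rightarrow> 'h) \<Rightarrow>
     'n list \<Rightarrow> 'h ^ 'n \<Rightarrow> 'h ^ 'n" where
  "transfer_function HC C E \<alpha> \<eta> =
     (if \<alpha> = [] then tilde_D HC C E \<eta> else 0) +
     (\<Sum>(\<beta>, j)\<in>{(\<beta>, j). \<beta> @ [j] = \<alpha>}.
        tilde_C HC C E (adj UNIV UNIV (word_op E (rev \<beta>)) (defect_comp_adj UNIV E j \<eta>)))"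

definition Psi_C :: "('n list, 'v::complex_inner) l2 \<Rightarrow> ('n list, 'v) l2" where
  "Psi_C y = (\<Sum>\<^sub>\<infinity>\<alpha>. fock_basis (rev \<alpha>) \<otimes>\<^sub>F coeff y \<alpha>)"

definition Psi_E :: "('n list, 'v::complex_inner) l2 \<Rightarrow> ('n list, 'v) l2" where
  "Psi_E g = fock_basis [] \<otimes>\<^sub>F coeff g []"

text \<open>The symbol \<open>\<Theta>\<^sub>C\<^sub>,\<^sub>E : e\<^sub>\<emptyset> \<otimes> \<D>\<^sub>E \<rightarrow> \<Gamma> \<otimes> \<D>\<^sub>C\<close>, set to \<open>0\<close> off its domain so that it is unique
  as a function on the whole type.\<close>

definition is_char_symbol ::
    "'h::chilbert_space set \<Rightarrow> ('n::finite \<Rightarrow> 'h \<Rightarrow> 'h) \<Rightarrow> ('n \<Rightarrow> 'h \<Rightarrow> 'h) \<Rightarrow> ('n \<Rightarrow> 'h \<Rightarrow> 'h) \<Rightarrow>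
     ('n \<Rightarrow> 'h \<Rightarrow> 'h) \<Rightarrow> ('h \<Rightarrow> 'h ^ 'n) \<Rightarrow> (('n list, 'h ^ 'n) l2 \<Rightarrow> ('n list, 'h ^ 'n) l2) \<Rightarrow> bool" where
  "is_char_symbol HC C E A B \<gamma> \<Theta> \<longleftrightarrow>
     bounded_op ((\<otimes>\<^sub>F) (fock_basis []) ` defect_space UNIV E) (l2_in (defect_space HC C)) \<Theta> \<and>
     (\<forall>g. g \<notin> (\<otimes>\<^sub>F) (fock_basis []) ` defect_space UNIV E \<longrightarrow> \<Theta> g = 0) \<and>
     (\<forall>i. \<forall>h\<in>HC. \<exists>S.
        ((\<lambda>\<alpha>. fock_basis \<alpha> \<otimes>\<^sub>F
            \<gamma> (star_defect_op (orth HC) A (adj (orth HC) (orth HC) (word_op A \<alpha>) (B i h))))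
          has_sum S) {\<alpha>. length \<alpha> \<ge> 1} \<and>
        \<Theta> (fock_basis [] \<otimes>\<^sub>F defect_comp UNIV E i h) =
          fock_basis [] \<otimes>\<^sub>F (defect_comp HC C i h - \<gamma> (star_defect_op (orth HC) A (B i h))) - S) \<and>
     (\<forall>i. \<forall>h\<in>orth HC. \<exists>S.
        (\<forall>j. ((\<lambda>\<alpha>. fock_basis (j # \<alpha>) \<otimes>\<^sub>F
            \<gamma> (star_defect_op (orth HC) A (adj (orth HC) (orth HC) (word_op A \<alpha>)
              ((if i = j then h else 0) - adj (orth HC) (orth HC) (A j) (A i h)))))
          has_sum S j) UNIV) \<and>
        \<Theta> (fock_basis [] \<otimes>\<^sub>F defect_comp UNIV E i h) =
          - (fock_basis [] \<otimes>\<^sub>F \<gamma> (star_defect_op (orth HC) A (A i h))) + (\<Sum>j\<in>UNIV. S j))"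

definition char_function ::
    "'h::chilbert_space set \<Rightarrow> ('n::finite \<Rightarrow> 'h \<Rightarrow> 'h) \<Rightarrow> ('n \<Rightarrow> 'h \<Rightarrow> 'h) \<Rightarrow> ('n \<Rightarrow> 'h \<Rightarrow> 'h) \<Rightarrow>
     ('n \<Rightarrow> 'h \<Rightarrow> 'h) \<Rightarrow> ('h \<Rightarrow> 'h ^ 'n) \<Rightarrow> ('n list, 'h ^ 'n) l2 \<Rightarrow> ('n list, 'h ^ 'n) l2" where
  "char_function HC C E A B \<gamma> = (THE \<Theta>. is_char_symbol HC C E A B \<gamma> \<Theta>)"

end

theory Submission
  imports Defs
begin

text \<open>Write \<open>Q\<close> for the projection of \<open>\<H>\<^sub>E\<close> onto \<open>\<H>\<^sub>C\<close> and \<open>Q' = I - Q\<close>.  Both sides of the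
  identity are computed explicitly, and both turn out to be the family

    \<open>\<emptyset> \<mapsto> D\<^sub>C (Q \<eta>\<^sub>j)\<^sub>j\<close>,  \<open>j\<beta> \<mapsto> B\<^sup>* (A\<^sub>\<beta>)\<^sup>* Q' \<eta>\<^sub>j\<close>,

  which is called \<open>symbol \<eta>\<close> below.

  Since \<open>C\<close> and \<open>E\<close> are coisometric, \<open>D\<^sub>C\<close> and \<open>D\<^sub>E\<close> are orthogonal projections: they project
  onto the kernels of the row operators \<open>C\<close> and \<open>E\<close> (\<open>defect_op_eq\<close>, \<open>defect_space_eq\<close>).
  Hence \<open>(D\<^sub>E)\<^sub>j\<^sup>*\<close> just takes the \<open>j\<close>-th component.  The adjoint of the lower triangular \<open>E\<^sub>j\<close> is
  upper triangular (\<open>E_adj\<close>), so \<open>Q' (E\<^sub>\<alpha>)\<^sup>* = (A\<^sub>\<alpha>)\<^sup>* Q'\<close> and \<open>Q E\<^sup>* = C\<^sup>* Q + B\<^sup>* Q'\<close>.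
  The defect projection of \<open>C\<close> annihilates the range of \<open>C\<^sup>*\<close>, and it fixes the range of \<open>B\<^sup>*\<close>
  because \<open>C B\<^sup>* = 0\<close> is an entry of \<open>E E\<^sup>* = I\<close>.  This gives \<open>tilde_C = B\<^sup>* Q'\<close> and so the
  coefficients of the transfer function (\<open>transfer_function_eq\<close>).

  On the other side, apart from the summand \<open>(D\<^sub>C)\<^sub>i h\<close> at the empty word, the coefficients in the
  expansions of the characteristic function have the form \<open>\<gamma> D\<^sub>*\<^sub>,\<^sub>A x\<close>, which is \<open>B\<^sup>* x\<close> by the
  choice of \<open>\<gamma>\<close>.  Inserting \<open>\<eta> = (D\<^sub>E)\<^sub>i h = (\<delta>\<^sub>i\<^sub>j h - E\<^sub>j\<^sup>* E\<^sub>i h)\<^sub>j\<close> into the family above yields these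
  expansions (\<open>symbol_defect_comp_HC\<close>, \<open>symbol_defect_comp_HA\<close>), and they determine a bounded
  operator because the vectors \<open>(D\<^sub>E)\<^sub>i h\<close> span \<open>\<D>\<^sub>E\<close> (\<open>bounded_op_eq_on_defect_space\<close>).

  What remains is analysis.  The family is square summable, with square sum at most \<open>\<parallel>\<eta>\<parallel>\<^sup>2\<close>:
  iterating \<open>\<parallel>B\<^sup>* x\<parallel>\<^sup>2 + \<Sum>\<^sub>j \<parallel>A\<^sub>j\<^sup>* x\<parallel>\<^sup>2 = \<parallel>x\<parallel>\<^sup>2\<close>, another entry of \<open>E E\<^sup>* = I\<close>, telescopes
  (\<open>sum_B_adj_A_adj_words_le\<close>).  Adjoints and orthogonal projections exist by the Riesz
  representation theorem, and positive square roots of projections are unique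
  (\<open>psqrt_projection\<close>).\<close>

section \<open>Complex inner products and the Riesz representation theorem\<close>

lemma cinner_add_right: "cinner x (y + z) = cinner x y + cinner x z"
  using cinner_commute[of x "y + z"] cinner_commute[of x y] cinner_commute[of x z]
  by (simp add: cinner_add_left)

lemma cinner_scaleC_right: "cinner x (c *\<^sub>C y) = cnj c * cinner x y"
  using cinner_commute[of x "c *\<^sub>C y"] cinner_commute[of x y]
  by (simp add: cinner_scaleC_left)

lemma cinner_zero_left [simp]: "cinner 0 y = 0"
  using cinner_scaleC_left[of 0 0 y] by (simp add: scaleC_0_1)

lemma cinner_zero_right [simp]: "cinner x 0 = 0"
  using cinner_scaleC_right[of x 0 0] by (simp add: scaleC_0_1)

lemma scaleC_minus_1: "(- 1) *\<^sub>C x = - x" for x :: "'a::complex_inner"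
  using scaleR_scaleC[of "-1" x] by simp

lemma scaleC_zero_right [simp]: "c *\<^sub>C 0 = (0 :: 'a::complex_inner)"
  using scaleC_add_right[of c "0::'a" 0] by simp

lemma scaleC_minus_right: "c *\<^sub>C (- x) = - (c *\<^sub>C x)" for x :: "'a::complex_inner"
  using scaleC_add_right[of c x "- x"] by (simp add: eq_neg_iff_add_eq_0 add.commute)

lemma scaleC_diff_right: "c *\<^sub>C (x - y) = c *\<^sub>C x - c *\<^sub>C y" for x y :: "'a::complex_inner"
  using scaleC_add_right[of c x "- y"] by (simp add: scaleC_minus_right)

lemma cinner_minus_left: "cinner (- x) y = - cinner x y"
  using cinner_scaleC_left[of "-1" x y] by (simp add: scaleC_minus_1)

lemma cinner_minus_right: "cinner x (- y) = - cinner x y"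
  using cinner_scaleC_right[of x "-1" y] by (simp add: scaleC_minus_1)

lemma cinner_diff_left: "cinner (x - y) z = cinner x z - cinner y z"
  using cinner_add_left[of x "- y" z] by (simp add: cinner_minus_left)

lemma cinner_diff_right: "cinner x (y - z) = cinner x y - cinner x z"
  using cinner_add_right[of x y "- z"] by (simp add: cinner_minus_right)

lemma cinner_sum_left: "cinner (\<Sum>i\<in>I. f i) y = (\<Sum>i\<in>I. cinner (f i) y)"
  by (induction I rule: infinite_finite_induct) (auto simp: cinner_add_left)

lemma cinner_eq_zero_iff [simp]: "cinner x x = 0 \<longleftrightarrow> x = 0"
  by (simp add: cinner_self)

lemma cinner_eq_zero_sym: "cinner x y = 0 \<Longrightarrow> cinner y x = 0"
  using cinner_commute[of y x] by simp

lemma norm_add_orthogonal: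
  assumes "cinner x y = 0"
  shows "(norm (x + y))\<^sup>2 = (norm x)\<^sup>2 + (norm y)\<^sup>2"
  using assms by (simp add: power2_norm_eq_inner inner_eq_Re_cinner cinner_add_left
      cinner_add_right cinner_eq_zero_sym)

lemma cinner_conv_inner: "cinner x y = Complex (inner x y) (inner x (\<i> *\<^sub>C y))"
  by (simp add: complex_eq_iff inner_eq_Re_cinner cinner_scaleC_right)

text \<open>The functional \<open>x \<mapsto> \<parallel>x\<parallel>\<^sup>2 - 2 f x\<close> is bounded below on \<open>S\<close>, and by the parallelogram law a
  minimising sequence is Cauchy.  Its limit represents \<open>f\<close>: the first variation vanishes there.\<close>

lemma riesz_representation:
  fixes S :: "'a::{real_inner, complete_space} set"
  assumes "closed S" "subspace S"
    and add: "\<And>x y. x \<in> S \<Longrightarrow> y \<in> S \<Longrightarrow> f (x + y) = f x + f y"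
    and scale: "\<And>r x. x \<in> S \<Longrightarrow> f (scaleR r x) = r * f x"
    and bound: "\<And>x. x \<in> S \<Longrightarrow> \<bar>f x\<bar> \<le> K * norm x"
  obtains p where "p \<in> S" "\<And>u. u \<in> S \<Longrightarrow> f u = inner u p"
proof -
  define \<phi> where "\<phi> x = (norm x)\<^sup>2 - 2 * f x" for x
  define m where "m = Inf (\<phi> ` S)"
  have "- K\<^sup>2 \<le> \<phi> x" if "x \<in> S" for x
    using bound[OF that] zero_le_power2[of "norm x - K"]
    by (simp add: \<phi>_def power2_diff algebra_simps abs_le_iff)
  then have bdd: "bdd_below (\<phi> ` S)" by (rule bdd_belowI2)
  have m_le: "m \<le> \<phi> x" if "x \<in> S" for x
    unfolding m_def using bdd that by (auto intro: cInf_lower)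
  have "0 \<in> S" using \<open>subspace S\<close> by (rule subspace_0)
  have "\<exists>x\<in>S. \<phi> x < m + e" if "e > 0" for e
    using cInf_lessD[of "\<phi> ` S" "m + e"] \<open>0 \<in> S\<close> that unfolding m_def by auto
  then have "\<forall>n. \<exists>x\<in>S. \<phi> x < m + 1 / real (Suc n)" by simp
  then obtain X where X: "\<And>n. X n \<in> S" "\<And>n. \<phi> (X n) < m + 1 / real (Suc n)"
    by metis
  have parallelogram: "(norm (x - y))\<^sup>2 \<le> 2 * (\<phi> x - m) + 2 * (\<phi> y - m)"
    if "x \<in> S" "y \<in> S" for x y
  proof -
    let ?c = "scaleR (1/2) (x + y)"
    have "?c \<in> S" "x + y \<in> S"
      using that \<open>subspace S\<close> by (auto intro: subspace_add subspace_scale)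
    have "f ?c = (f x + f y) / 2"
      using scale[OF \<open>x + y \<in> S\<close>, of "1/2"] that by (simp add: add)
    moreover have "(norm ?c)\<^sup>2 = (norm (x + y))\<^sup>2 / 4"
      by (simp add: power_divide)
    moreover have "(norm (x - y))\<^sup>2 + (norm (x + y))\<^sup>2 = 2 * (norm x)\<^sup>2 + 2 * (norm y)\<^sup>2"
      by (simp add: power2_norm_eq_inner inner_add_left inner_add_right inner_diff_left
          inner_diff_right inner_commute)
    ultimately show ?thesis
      using m_le[OF \<open>?c \<in> S\<close>] by (simp add: \<phi>_def field_simps)
  qed
  have "Cauchy X"
  proof (rule metric_CauchyI)
    fix e :: real assume "e > 0"
    then obtain N where N: "4 / real (Suc N) < e\<^sup>2"
      using reals_Archimedean[of "e\<^sup>2 / 4"] by (auto simp: field_simps)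
    have "dist (X k) (X n) < e" if "k \<ge> N" "n \<ge> N" for k n
    proof -
      define r where "r j = 1 / real (Suc j)" for j
      have "r k \<le> r N" "r n \<le> r N"
        using that by (simp_all add: r_def field_simps)
      moreover have "\<phi> (X k) < m + r k" "\<phi> (X n) < m + r n" using X(2) by (simp_all add: r_def)
      ultimately have "2 * (\<phi> (X k) - m) + 2 * (\<phi> (X n) - m) \<le> 4 * r N"
        by argo
      then have "(norm (X k - X n))\<^sup>2 \<le> 4 * r N"
        using parallelogram[OF X(1)[of k] X(1)[of n]] by argo
      then have "(norm (X k - X n))\<^sup>2 \<le> 4 / real (Suc N)"
        by (simp add: r_def)
      then have "(norm (X k - X n))\<^sup>2 < e\<^sup>2" using N by linarith
      then show ?thesis
        using \<open>e > 0\<close> by (auto simp: dist_norm intro: power2_less_imp_less)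
    qed
    then show "\<exists>N. \<forall>k\<ge>N. \<forall>n\<ge>N. dist (X k) (X n) < e" by blast
  qed
  then obtain p where p: "X \<longlonglongrightarrow> p"
    using Cauchy_convergent_iff convergent_def by blast
  have "p \<in> S" using \<open>closed S\<close> X(1) p by (rule closed_sequentially)
  have "(\<lambda>n. f (X n) - f p) \<longlonglongrightarrow> 0"
  proof (rule Lim_null_comparison)
    show "(\<lambda>n. K * norm (X n - p)) \<longlonglongrightarrow> 0"
      using tendsto_mult_right_zero tendsto_norm_zero LIM_zero p by blast
    have "f (X n) - f p = f (X n - p)" for n
    proof -
      have "X n - p \<in> S" using X(1) \<open>p \<in> S\<close> \<open>subspace S\<close> by (simp add: subspace_diff)
      from add[OF this \<open>p \<in> S\<close>] show ?thesis by simp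
    qed
    then show "\<forall>\<^sub>F n in sequentially. norm (f (X n) - f p) \<le> K * norm (X n - p)"
      using bound X(1) \<open>p \<in> S\<close> \<open>subspace S\<close> by (simp add: subspace_diff)
  qed
  then have "(\<lambda>n. f (X n)) \<longlonglongrightarrow> f p" by (rule LIM_zero_cancel)
  then have "(\<lambda>n. \<phi> (X n)) \<longlonglongrightarrow> \<phi> p"
    unfolding \<phi>_def by (intro tendsto_intros p)
  moreover have "(\<lambda>n. m + 1 / real (Suc n)) \<longlonglongrightarrow> m + 0"
    by (intro tendsto_intros LIMSEQ_Suc[OF lim_1_over_n])
  ultimately have "\<phi> p \<le> m + 0"
    by (rule LIMSEQ_le) (use X(2) less_imp_le in blast)
  have "f u = inner u p" if "u \<in> S" for u
  proof (rule ccontr)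
    assume neq: "f u \<noteq> inner u p"
    define d where "d = inner u p - f u"
    \<comment> \<open>The step \<open>t\<close> almost minimises \<open>\<phi> (p + t u)\<close>; adding \<open>1\<close> keeps \<open>s\<close> positive when \<open>u = 0\<close>.\<close>
    define s where "s = (norm u)\<^sup>2 + 1"
    define t where "t = - d / s"
    have "s > 0" by (simp add: s_def add_nonneg_pos)
    have "scaleR t u \<in> S" using that \<open>subspace S\<close> by (simp add: subspace_scale)
    then have "p + scaleR t u \<in> S" using \<open>p \<in> S\<close> \<open>subspace S\<close> by (simp add: subspace_add)
    then have "\<phi> p \<le> \<phi> (p + scaleR t u)" using m_le \<open>\<phi> p \<le> m + 0\<close> by fastforce
    also have "\<dots> = \<phi> p + t\<^sup>2 * (norm u)\<^sup>2 + 2 * t * d"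
      using add[OF \<open>p \<in> S\<close> \<open>scaleR t u \<in> S\<close>] scale[OF that, of t]
      by (simp only: \<phi>_def d_def power2_norm_eq_inner inner_add_left inner_add_right
          inner_scaleR_left inner_scaleR_right inner_commute[of p u])
        (simp add: power2_eq_square algebra_simps)
    also have "\<dots> \<le> \<phi> p + t\<^sup>2 * s + 2 * t * d"
      by (simp add: s_def algebra_simps)
    also have "\<dots> = \<phi> p - d\<^sup>2 / s"
      using \<open>s > 0\<close> by (simp add: t_def field_simps power2_eq_square)
    finally have "d\<^sup>2 / s \<le> 0" by simp
    moreover have "d\<^sup>2 / s > 0" using neq \<open>s > 0\<close> by (simp add: d_def)
    ultimately show False by simp
  qed
  with \<open>p \<in> S\<close> show ?thesis by (rule that)
qed

section \<open>Closed subspaces, adjoints and projections\<close>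

lemma closed_csubspaceD:
  assumes "closed_csubspace X"
  shows "closed X" "0 \<in> X" "x \<in> X \<Longrightarrow> y \<in> X \<Longrightarrow> x + y \<in> X" "x \<in> X \<Longrightarrow> c *\<^sub>C x \<in> X"
    "x \<in> X \<Longrightarrow> - x \<in> X" "x \<in> X \<Longrightarrow> y \<in> X \<Longrightarrow> x - y \<in> X"
proof -
  show *: "closed X" "0 \<in> X" "\<And>x y. x \<in> X \<Longrightarrow> y \<in> X \<Longrightarrow> x + y \<in> X"
      "\<And>c x. x \<in> X \<Longrightarrow> c *\<^sub>C x \<in> X"
    using assms unfolding closed_csubspace_def by auto
  show **: "- x \<in> X" if "x \<in> X" for x
    using *(4)[OF that, of "-1"] by (simp add: scaleC_minus_1)
  show "x - y \<in> X" if "x \<in> X" "y \<in> X"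
    using *(3)[OF that(1) **[OF that(2)]] by simp
qed

lemma closed_csubspace_sum:
  assumes "closed_csubspace X" "\<And>i. i \<in> I \<Longrightarrow> f i \<in> X"
  shows "(\<Sum>i\<in>I. f i) \<in> X"
  using assms(2)
  by (induction I rule: infinite_finite_induct) (auto intro: closed_csubspaceD[OF assms(1)])

lemma closed_csubspace_UNIV: "closed_csubspace UNIV"
  by (simp add: closed_csubspace_def)

lemma closed_csubspace_orth: "closed_csubspace (orth X)"
proof -
  have "orth X = (\<Inter>x\<in>X. {y. cinner y x = 0})"
    by (auto simp: orth_def)
  moreover have "closed {y. cinner y x = 0}" for x :: 'a
    unfolding cinner_conv_inner complex_eq_iff complex.sel zero_complex.sel
    by (intro closed_Collect_conj closed_Collect_eq continuous_intros)
  ultimately have "closed (orth X)" by auto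
  then show ?thesis
    by (auto simp: closed_csubspace_def orth_def cinner_add_left cinner_scaleC_left)
qed

lemma cinner_orth:
  assumes "x \<in> X" "y \<in> orth X"
  shows "cinner y x = 0" "cinner x y = 0"
  using assms by (auto simp: orth_def intro: cinner_eq_zero_sym)

lemma eq_zero_if_in_orth: "x \<in> X \<Longrightarrow> x \<in> orth X \<Longrightarrow> x = 0"
  using cinner_orth(1)[of x X x] by simp

lemma closed_csubspace_dsum:
  fixes X :: "'a::chilbert_space set"
  assumes "closed_csubspace X"
  shows "closed_csubspace (dsum X :: ('a ^ 'b::finite) set)"
proof -
  have "(dsum X :: ('a ^ 'b) set) = (\<Inter>j. (\<lambda>x. x $ j) -` X)" by (auto simp: dsum_def)
  moreover have "closed ((\<lambda>x :: 'a ^ 'b. x $ j) -` X)" for j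
    using closed_csubspaceD(1)[OF assms] by (intro closed_vimage continuous_intros)
  ultimately have "closed (dsum X :: ('a ^ 'b) set)" by auto
  then show ?thesis
    using closed_csubspaceD[OF assms]
    by (auto simp: closed_csubspace_def dsum_def scaleC_vec_def)
qed

lemma bounded_opD:
  assumes "bounded_op X Y T"
  shows "x \<in> X \<Longrightarrow> T x \<in> Y" "x \<in> X \<Longrightarrow> y \<in> X \<Longrightarrow> T (x + y) = T x + T y"
    "x \<in> X \<Longrightarrow> T (c *\<^sub>C x) = c *\<^sub>C T x"
  using assms unfolding bounded_op_def by auto

lemma bounded_op_linear:
  assumes "bounded_op X Y T" "closed_csubspace X"
  shows "T 0 = 0" "x \<in> X \<Longrightarrow> T (- x) = - T x" "x \<in> X \<Longrightarrow> y \<in> X \<Longrightarrow> T (x - y) = T x - T y"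
proof -
  note X = closed_csubspaceD[OF assms(2)]
  show "T 0 = 0" using bounded_opD(3)[OF assms(1) X(2), of 0] by (simp add: scaleC_0_1)
  show *: "T (- x) = - T x" if "x \<in> X" for x
    using bounded_opD(3)[OF assms(1) that, of "-1"] by (simp add: scaleC_minus_1)
  show "T (x - y) = T x - T y" if "x \<in> X" "y \<in> X"
    using bounded_opD(2)[OF assms(1) that(1) X(5)[OF that(2)]] *[OF that(2)] by simp
qed

lemma bounded_op_sum:
  assumes "bounded_op X Y T" "closed_csubspace X" "\<And>i. i \<in> I \<Longrightarrow> f i \<in> X"
  shows "T (\<Sum>i\<in>I. f i) = (\<Sum>i\<in>I. T (f i))"
  using assms(3)
proof (induction I rule: infinite_finite_induct)
  case (insert i I)
  then show ?case
    using bounded_opD(2)[OF assms(1) _ closed_csubspace_sum[OF assms(2)], of "f i" I f] by simp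
qed (simp_all add: bounded_op_linear(1)[OF assms(1,2)])

lemma bounded_op_id: "bounded_op X UNIV id"
  by (auto simp: bounded_op_def intro!: exI[of _ 1])

lemma bounded_op_comp:
  assumes "bounded_op X Y S" "bounded_op Y Z T"
  shows "bounded_op X Z (T \<circ> S)"
proof -
  obtain K L where K: "\<forall>x\<in>X. norm (S x) \<le> K * norm x" and L: "\<forall>y\<in>Y. norm (T y) \<le> L * norm y"
    using assms unfolding bounded_op_def by blast
  have "norm (T (S x)) \<le> (\<bar>L\<bar> * K) * norm x" if "x \<in> X" for x
  proof -
    have "norm (T (S x)) \<le> L * norm (S x)" using L bounded_opD(1)[OF assms(1) that] by blast
    also have "\<dots> \<le> \<bar>L\<bar> * norm (S x)" by (simp add: mult_right_mono)
    also have "\<dots> \<le> \<bar>L\<bar> * (K * norm x)" using K that by (simp add: mult_left_mono)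
    finally show ?thesis by (simp add: mult.assoc)
  qed
  then show ?thesis
    using assms unfolding bounded_op_def by auto
qed

lemma cinner_left_eqI:
  assumes "closed_csubspace X" "x \<in> X" "y \<in> X" "\<And>u. u \<in> X \<Longrightarrow> cinner u x = cinner u y"
  shows "x = y"
proof -
  have "cinner (x - y) (x - y) = 0"
    using assms(4)[OF closed_csubspaceD(6)[OF assms(1-3)]] by (simp add: cinner_diff_right)
  then show ?thesis by simp
qed

lemma adj_eqI:
  assumes "closed_csubspace X" "x \<in> X" "\<And>u. u \<in> X \<Longrightarrow> cinner (T u) y = cinner u x"
  shows "adj X Y T y = x"
  unfolding adj_def
proof (rule the_equality)
  show "x \<in> X \<and> (\<forall>u\<in>X. cinner (T u) y = cinner u x)" using assms by blast
  fix x' assume "x' \<in> X \<and> (\<forall>u\<in>X. cinner (T u) y = cinner u x')"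
  then show "x' = x" using assms cinner_left_eqI[OF assms(1)] by metis
qed

text \<open>Existence of the adjoint: for each \<open>y\<close> the functional \<open>u \<mapsto> Re \<langle>T u, y\<rangle>\<close> has a Riesz
  representative \<open>p\<close> in \<open>X\<close>.  Complex linearity of \<open>T\<close>, applied to \<open>\<i> u\<close>, makes \<open>p\<close> represent the
  imaginary part as well.\<close>

lemma adj_characterization:
  assumes "bounded_op X Y T" "closed_csubspace X"
  shows "adj X Y T y \<in> X" "u \<in> X \<Longrightarrow> cinner (T u) y = cinner u (adj X Y T y)"
proof -
  note X = closed_csubspaceD[OF assms(2)] and T = bounded_opD[OF assms(1)]
  obtain K where K: "\<And>x. x \<in> X \<Longrightarrow> norm (T x) \<le> K * norm x"
    using assms unfolding bounded_op_def by blast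
  have "\<exists>p\<in>X. \<forall>u\<in>X. inner (T u) y = inner u p"
  proof (rule riesz_representation[where f = "\<lambda>u. inner (T u) y" and S = X and K = "norm y * K"])
    show "subspace X"
      using X by (auto simp: subspace_def scaleR_scaleC)
    show "\<bar>inner (T u) y\<bar> \<le> norm y * K * norm u" if "u \<in> X" for u
      using Cauchy_Schwarz_ineq2[of "T u" y] mult_left_mono[OF K[OF that], of "norm y"]
      by (simp add: mult.assoc mult.commute[of "norm y" "norm (T u)"])
  qed (auto simp: X T scaleR_scaleC inner_eq_Re_cinner cinner_add_left cinner_scaleC_left)
  then obtain p where "p \<in> X" and p: "\<And>u. u \<in> X \<Longrightarrow> inner (T u) y = inner u p" by blast
  have "cinner (T u) y = cinner u p" if "u \<in> X" for u
    using p[OF that] p[OF X(4)[OF that, of \<i>]]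
    by (simp add: T(3)[OF that] complex_eq_iff inner_eq_Re_cinner cinner_scaleC_left)
  moreover from this have "adj X Y T y = p"
    using assms(2) \<open>p \<in> X\<close> by (intro adj_eqI)
  ultimately show "adj X Y T y \<in> X" "u \<in> X \<Longrightarrow> cinner (T u) y = cinner u (adj X Y T y)"
    using \<open>p \<in> X\<close> by auto
qed

lemma bounded_op_adj:
  assumes "bounded_op X Y T" "closed_csubspace X"
  shows "bounded_op Z X (adj X Y T)"
proof -
  note X = closed_csubspaceD[OF assms(2)] and a = adj_characterization[OF assms]
  obtain K where K: "\<And>x. x \<in> X \<Longrightarrow> norm (T x) \<le> K * norm x"
    using assms unfolding bounded_op_def by blast
  have "norm (adj X Y T y) \<le> \<bar>K\<bar> * norm y" for y
  proof (cases "adj X Y T y = 0")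
    case False
    let ?x = "adj X Y T y"
    have "norm ?x * norm ?x = inner (T ?x) y"
      using a(2)[OF a(1)[of y], of y]
      by (simp add: inner_eq_Re_cinner cinner_self power2_eq_square)
    also have "\<dots> \<le> norm (T ?x) * norm y" by (rule norm_cauchy_schwarz)
    also have "\<dots> \<le> (\<bar>K\<bar> * norm ?x) * norm y"
      using K[OF a(1)[of y]] mult_right_mono[OF abs_ge_self[of K] norm_ge_zero[of ?x]]
      by (intro mult_right_mono) auto
    finally have "norm ?x * norm ?x \<le> norm ?x * (\<bar>K\<bar> * norm y)" by (simp add: mult.left_commute mult.commute)
    then show ?thesis using False by simp
  qed simp
  moreover have "adj X Y T (x + y) = adj X Y T x + adj X Y T y" for x y
    by (rule adj_eqI[OF assms(2)]) (auto intro!: X a(1) simp: cinner_add_right a(2))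
  moreover have "adj X Y T (c *\<^sub>C x) = c *\<^sub>C adj X Y T x" for c x
    by (rule adj_eqI[OF assms(2)]) (auto intro!: X a(1) simp: cinner_scaleC_right a(2))
  ultimately show ?thesis unfolding bounded_op_def using a(1) by blast
qed

lemma proj_eqI:
  assumes "closed_csubspace X" "p \<in> X" "y - p \<in> orth X"
  shows "proj X y = p"
  unfolding proj_def
proof (rule the_equality)
  show "p \<in> X \<and> y - p \<in> orth X" using assms by blast
  fix q assume q: "q \<in> X \<and> y - q \<in> orth X"
  then have "p - q \<in> X" using assms closed_csubspaceD(6) by blast
  moreover have "(y - q) - (y - p) \<in> orth X"
    using q assms(3) closed_csubspaceD(6)[OF closed_csubspace_orth] by blast
  ultimately show "q = p" using eq_zero_if_in_orth[of "p - q" X] by simp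
qed

text \<open>The adjoint of the inclusion of \<open>X\<close> into the whole space is the orthogonal projection
  onto \<open>X\<close>, which reduces its existence to that of adjoints.\<close>

lemma proj_eq_adj:
  assumes "closed_csubspace X"
  shows "proj X = adj X UNIV id"
proof
  fix y
  note a = adj_characterization[OF bounded_op_id assms]
  show "proj X y = adj X UNIV id y"
  proof (rule proj_eqI[OF assms a(1)])
    have "cinner (y - adj X UNIV id y) u = 0" if "u \<in> X" for u
      using a(2)[OF that, of y] by (simp add: cinner_diff_right cinner_eq_zero_sym[of u])
    then show "y - adj X UNIV id y \<in> orth X" by (simp add: orth_def)
  qed
qed

lemma proj_bounded_op:
  assumes "closed_csubspace X"
  shows "bounded_op UNIV X (proj X)"
  unfolding proj_eq_adj[OF assms]
  by (rule bounded_op_adj[OF bounded_op_id assms])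

lemma proj_orth:
  assumes "closed_csubspace X"
  shows "y - proj X y \<in> orth X"
proof -
  have "cinner (y - proj X y) u = 0" if "u \<in> X" for u
    using adj_characterization(2)[OF bounded_op_id assms that, of y] unfolding proj_eq_adj[OF assms]
    by (simp add: cinner_diff_right cinner_eq_zero_sym[of u])
  then show ?thesis by (simp add: orth_def)
qed

text \<open>A projection is its own positive square root, and it has no other one: a positive \<open>S\<close> with
  \<open>S\<^sup>2 = P\<close> vanishes on the kernel of \<open>P\<close>, and \<open>S z \<noteq> z\<close> for a fixed point \<open>z\<close> of \<open>P\<close> would make
  \<open>S z - z\<close> an eigenvector of \<open>S\<close> with eigenvalue \<open>-1\<close>.\<close>

lemma psqrt_projection:
  assumes X: "closed_csubspace X" and P: "bounded_op X X P"
    and idem: "\<And>x. x \<in> X \<Longrightarrow> P (P x) = P x"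
    and self_adjoint: "\<And>x y. x \<in> X \<Longrightarrow> y \<in> X \<Longrightarrow> cinner (P x) y = cinner x (P y)"
    and "x \<in> X"
  shows "psqrt X P x = P x"
proof -
  note XD = closed_csubspaceD[OF X] and PD = bounded_opD[OF P] bounded_op_linear[OF P X]
  define R where "R = (\<lambda>x. if x \<in> X then P x else 0)"
  have "psqrt X P = R"
    unfolding psqrt_def
  proof (rule the_equality)
    have "cinner (P x) x \<in> \<real>\<^sub>\<ge>\<^sub>0" if "x \<in> X" for x
      using self_adjoint[OF PD(1)[OF that] that]
      by (simp add: idem that cinner_self nonneg_Reals_of_real_iff del: of_real_power)
    moreover have "bounded_op X X R"
      using P XD unfolding bounded_op_def R_def by auto
    ultimately show "bounded_op X X R \<and> (\<forall>x\<in>X. cinner (R x) x \<in> \<real>\<^sub>\<ge>\<^sub>0) \<and>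
        (\<forall>x\<in>X. R (R x) = P x) \<and> (\<forall>x. x \<notin> X \<longrightarrow> R x = 0)"
      using PD(1) idem by (simp add: R_def)
    fix S assume *: "bounded_op X X S \<and> (\<forall>x\<in>X. cinner (S x) x \<in> \<real>\<^sub>\<ge>\<^sub>0) \<and>
        (\<forall>x\<in>X. S (S x) = P x) \<and> (\<forall>x. x \<notin> X \<longrightarrow> S x = 0)"
    then have S: "bounded_op X X S" and pos: "\<And>x. x \<in> X \<Longrightarrow> cinner (S x) x \<in> \<real>\<^sub>\<ge>\<^sub>0"
      and sq: "\<And>x. x \<in> X \<Longrightarrow> S (S x) = P x" and off: "\<And>x. x \<notin> X \<Longrightarrow> S x = 0" by auto
    note SD = bounded_opD[OF S] bounded_op_linear[OF S X]
    have ker: "S x = 0" if "x \<in> X" "P x = 0" for x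
    proof (rule ccontr)
      define y where "y = S x"
      assume "S x \<noteq> 0"
      then have "(norm y)\<^sup>2 > 0" by (simp add: y_def)
      have "y \<in> X" "S y = 0" using that SD(1) sq by (auto simp: y_def)
      define t where "t = - (Re (cinner y x) + 1) / (norm y)\<^sup>2"
      \<comment> \<open>The quadratic form of \<open>S\<close> at \<open>x + t y\<close> is affine in \<open>t\<close>, so it takes negative values.\<close>
      have "cinner (S (x + of_real t *\<^sub>C y)) (x + of_real t *\<^sub>C y) = cinner y x + t * (norm y)\<^sup>2"
        using that \<open>y \<in> X\<close> \<open>S y = 0\<close> XD(4)[OF \<open>y \<in> X\<close>]
        by (simp add: SD y_def[symmetric] cinner_add_right cinner_scaleC_right cinner_self)
      moreover have "Re (cinner (S (x + of_real t *\<^sub>C y)) (x + of_real t *\<^sub>C y)) \<ge> 0"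
        using pos[of "x + of_real t *\<^sub>C y"] that \<open>y \<in> X\<close> XD by (simp add: complex_nonneg_Reals_iff)
      moreover have "t * (norm y)\<^sup>2 = - (Re (cinner y x) + 1)"
        using \<open>(norm y)\<^sup>2 > 0\<close> unfolding t_def by (metis nonzero_eq_divide_eq less_irrefl)
      ultimately show False by (simp flip: of_real_power of_real_mult)
    qed
    have "S x = P x" if "x \<in> X" for x
    proof -
      define z where "z = P x"
      have "z \<in> X" "P z = z" using that PD(1) idem by (auto simp: z_def)
      have "S (x - z) = 0"
        using that \<open>z \<in> X\<close> \<open>P z = z\<close> XD(6) by (intro ker) (auto simp: PD z_def)
      then have "S x = S z" using that \<open>z \<in> X\<close> by (simp add: SD)
      define w where "w = S z - z"
      have "w \<in> X" using \<open>z \<in> X\<close> SD(1) XD(6) by (simp add: w_def)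
      have "S w = - w" using \<open>z \<in> X\<close> SD(1) \<open>P z = z\<close> by (simp add: w_def SD sq)
      then have "w = 0"
        using pos[OF \<open>w \<in> X\<close>]
        by (simp add: cinner_minus_left cinner_self complex_nonneg_Reals_iff flip: of_real_power)
      then show ?thesis using \<open>S x = S z\<close> by (simp add: w_def z_def)
    qed
    then show "S = R" using off by (auto simp: R_def)
  qed
  then show ?thesis using \<open>x \<in> X\<close> by (simp add: R_def)
qed

section \<open>The defect of a coisometric tuple\<close>

lemma cinner_axis_left: "cinner (axis j x) y = cinner x (y $ j)"
proof -
  have "cinner (axis j x) y = (\<Sum>i\<in>UNIV. if i = j then cinner x (y $ i) else 0)"
    unfolding cinner_vec_def by (intro sum.cong) (auto simp: axis_def)
  then show ?thesis by simp
qed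

lemma axis_in_dsum: "closed_csubspace X \<Longrightarrow> x \<in> X \<Longrightarrow> axis j x \<in> dsum X"
  using closed_csubspaceD(2) by (auto simp: dsum_def axis_def)

lemma sum_axis: "(\<Sum>j\<in>UNIV. axis j (x $ j)) = x" for x :: "'a::complex_inner ^ 'n::finite"
proof -
  have "(\<Sum>j\<in>UNIV. axis j (x $ j) $ i) = (\<Sum>j\<in>UNIV. if j = i then x $ j else 0)" for i
    by (intro sum.cong) (auto simp: axis_def)
  then show ?thesis by (simp add: vec_eq_iff)
qed

lemma norm_vec_sq: "(norm x)\<^sup>2 = (\<Sum>j\<in>UNIV. (norm (x $ j))\<^sup>2)"
  for x :: "'a::complex_inner ^ 'n::finite"
  by (simp add: power2_norm_eq_inner inner_vec_def)

lemma scaleC_sum_right: "c *\<^sub>C (\<Sum>i\<in>I. f i) = (\<Sum>i\<in>I. c *\<^sub>C f i)"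
  for f :: "'i \<Rightarrow> 'a::complex_inner"
  by (induction I rule: infinite_finite_induct) (auto simp: scaleC_add_right)

lemma bounded_op_row:
  assumes Y: "closed_csubspace Y" and T: "\<And>j. bounded_op X Y (T j)"
  shows "bounded_op (dsum X) Y (row T)"
proof -
  note TD = bounded_opD[OF T]
  have "\<forall>j. \<exists>K. \<forall>x\<in>X. norm (T j x) \<le> K * norm x"
    using T unfolding bounded_op_def by blast
  then obtain K where K: "\<And>j x. x \<in> X \<Longrightarrow> norm (T j x) \<le> K j * norm x" by metis
  have "norm (row T x) \<le> (\<Sum>j\<in>UNIV. \<bar>K j\<bar>) * norm x" if "x \<in> dsum X" for x
  proof -
    have "norm (T j (x $ j)) \<le> \<bar>K j\<bar> * norm x" for j
    proof -
      have "norm (T j (x $ j)) \<le> K j * norm (x $ j)" using that by (intro K) (simp add: dsum_def)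
      also have "\<dots> \<le> \<bar>K j\<bar> * norm (x $ j)" by (simp add: mult_right_mono)
      also have "\<dots> \<le> \<bar>K j\<bar> * norm x" by (simp add: mult_left_mono Finite_Cartesian_Product.norm_nth_le)
      finally show ?thesis .
    qed
    then show ?thesis by (simp add: row_def sum_distrib_right sum_norm_le)
  qed
  moreover have "row T (c *\<^sub>C x) = c *\<^sub>C row T x" if "x \<in> dsum X" for c x
    using that by (simp add: row_def dsum_def scaleC_vec_def TD scaleC_sum_right)
  ultimately show ?thesis
    unfolding bounded_op_def
    by (auto simp: row_def dsum_def TD sum.distrib intro!: closed_csubspace_sum[OF Y])
qed

lemma adj_row:
  assumes X: "closed_csubspace X" and T: "\<And>j. bounded_op X Y (T j)"
  shows "adj (dsum X) Y (row T) y = (\<chi> j. adj X Y (T j) y)"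
proof (rule adj_eqI[OF closed_csubspace_dsum[OF X]])
  note a = adj_characterization[OF T X]
  show "(\<chi> j. adj X Y (T j) y) \<in> dsum X" by (simp add: dsum_def a)
  show "cinner (row T u) y = cinner u (\<chi> j. adj X Y (T j) y)" if "u \<in> dsum X" for u
    using that by (simp add: row_def cinner_vec_def cinner_sum_left dsum_def a)
qed

locale coisometric_tuple =
  fixes X :: "'h::chilbert_space set" and T :: "'n::finite \<Rightarrow> 'h \<Rightarrow> 'h"
  assumes X: "closed_csubspace X" and coisometric: "coisometric X T"
begin

lemma op: "bounded_op X X (T j)"
  using coisometric by (simp add: coisometric_def)

lemma row_adjoints: "x \<in> X \<Longrightarrow> row T (\<chi> j. adj X X (T j) x) = x"
  using coisometric by (simp add: coisometric_def row_def)

lemma row_op: "bounded_op (dsum X) X (row T)"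
  using X op by (rule bounded_op_row)

lemma dsum_X: "closed_csubspace (dsum X :: ('h ^ 'n) set)"
  using X by (rule closed_csubspace_dsum)

abbreviation row_adj :: "'h \<Rightarrow> 'h ^ 'n" where
  "row_adj x \<equiv> \<chi> j. adj X X (T j) x"

lemma row_adj: "adj (dsum X) X (row T) = row_adj"
  using adj_row[where T = T, OF X op] by auto

lemma row_adj_op: "bounded_op X (dsum X) row_adj"
  using bounded_op_adj[OF row_op dsum_X, of X] by (simp add: row_adj)

lemma cinner_row: "u \<in> dsum X \<Longrightarrow> cinner (row T u) x = cinner u (row_adj x)"
  using adj_characterization(2)[OF row_op dsum_X] by (simp add: row_adj)

lemma cinner_row_adj: "u \<in> dsum X \<Longrightarrow> cinner (row_adj x) u = cinner x (row T u)"
  using cinner_row[of u x] cinner_commute[of "row_adj x" u] cinner_commute[of x "row T u"] by simp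

lemma norm_row_adj:
  assumes "x \<in> X"
  shows "norm (row_adj x) = norm x"
proof -
  have "cinner (row_adj x) (row_adj x) = cinner x x"
    using assms bounded_opD(1)[OF row_adj_op] by (simp add: cinner_row_adj row_adjoints)
  then show ?thesis
    by (simp add: cinner_self power2_eq_iff_nonneg flip: of_real_power)
qed

text \<open>Since \<open>T T\<^sup>* = I\<close>, the operator \<open>I - T\<^sup>* T\<close> is a projection and thus its own square root.
  Its range is the kernel of the row operator.\<close>

lemma defect_op_eq:
  assumes "x \<in> dsum X"
  shows "defect_op X T x = x - row_adj (row T x)"
  unfolding defect_op_def row_adj
proof (rule psqrt_projection[OF dsum_X _ _ _ assms])
  note R = bounded_opD[OF row_op] bounded_op_linear[OF row_op dsum_X]
  note A = bounded_opD[OF row_adj_op] bounded_op_linear[OF row_adj_op X]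
  note D = closed_csubspaceD[OF dsum_X]
  let ?P = "\<lambda>x. x - row_adj (row T x)"
  have P_in: "?P x \<in> dsum X" if "x \<in> dsum X" for x
    using that by (intro D A R)
  have row_P: "row T (?P x) = 0" if "x \<in> dsum X" for x
    using that R A by (simp add: row_adjoints)
  show "?P (?P x) = ?P x" if "x \<in> dsum X" for x
    unfolding row_P[OF that] A(4) by simp
  show sym: "cinner (?P x) y = cinner x (?P y)" if "x \<in> dsum X" "y \<in> dsum X" for x y
    using that R A by (simp add: cinner_diff_left cinner_diff_right cinner_row_adj
        cinner_row[symmetric])
  have contr: "norm (?P x) \<le> 1 * norm x" if "x \<in> dsum X" for x
  proof -
    have "cinner (?P x) (row_adj (row T x)) = 0"
      using cinner_row[OF P_in[OF that]] row_P[OF that] by simp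
    from norm_add_orthogonal[OF this] show ?thesis
      by - (rule power2_le_imp_le, simp_all)
  qed
  show "bounded_op (dsum X) (dsum X) ?P"
    unfolding bounded_op_def
  proof (intro conjI ballI allI exI)
    show "?P x \<in> dsum X" if "x \<in> dsum X" for x by (rule P_in[OF that])
    show "?P (x + y) = ?P x + ?P y" if "x \<in> dsum X" "y \<in> dsum X" for x y
      using that by (simp only: R A) simp
    show "?P (c *\<^sub>C x) = c *\<^sub>C ?P x" if "x \<in> dsum X" for c x
      using that by (simp only: R A scaleC_diff_right)
    show "norm (?P x) \<le> 1 * norm x" if "x \<in> dsum X" for x by (rule contr[OF that])
  qed
qed

lemma row_defect_op: "x \<in> dsum X \<Longrightarrow> row T (defect_op X T x) = 0"
  using bounded_opD(1)[OF row_op] bounded_opD(1)[OF row_adj_op]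
  by (simp add: defect_op_eq bounded_op_linear[OF row_op dsum_X] row_adjoints)

lemma defect_op_in_dsum: "x \<in> dsum X \<Longrightarrow> defect_op X T x \<in> dsum X"
  using bounded_opD(1)[OF row_op] bounded_opD(1)[OF row_adj_op] closed_csubspaceD(6)[OF dsum_X]
  by (simp add: defect_op_eq)

lemma defect_op_fixed: "x \<in> dsum X \<Longrightarrow> row T x = 0 \<Longrightarrow> defect_op X T x = x"
  using bounded_op_linear(1)[OF row_adj_op X] by (simp add: defect_op_eq)

lemma defect_op_row_adj: "x \<in> X \<Longrightarrow> defect_op X T (row_adj x) = 0"
  using bounded_opD(1)[OF row_adj_op] by (simp add: defect_op_eq row_adjoints)

lemma cinner_defect_op:
  assumes "x \<in> dsum X" "y \<in> dsum X" "row T y = 0"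
  shows "cinner (defect_op X T x) y = cinner x y"
  using assms by (simp add: defect_op_eq cinner_diff_left cinner_row_adj)

text \<open>The range of the defect projection is the kernel of the row operator.  It equals its closure,
  being the orthogonal complement of the range of the adjoint.\<close>

lemma defect_space_eq: "defect_space X T = {x \<in> dsum X. row T x = 0}"
proof -
  have eq: "{x \<in> dsum X. row T x = 0} = dsum X \<inter> orth (row_adj ` X)"
  proof (intro set_eqI iffI)
    fix x assume "x \<in> {x \<in> dsum X. row T x = 0}"
    then show "x \<in> dsum X \<inter> orth (row_adj ` X)" by (auto simp: orth_def cinner_row[symmetric])
  next
    fix x assume x: "x \<in> dsum X \<inter> orth (row_adj ` X)"
    then have "cinner (row T x) (row T x) = 0"
      using bounded_opD(1)[OF row_op] by (simp add: cinner_row orth_def)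
    then show "x \<in> {x \<in> dsum X. row T x = 0}" using x by simp
  qed
  have "defect_op X T ` dsum X = {x \<in> dsum X. row T x = 0}"
  proof (intro equalityI subsetI)
    fix x assume "x \<in> {x \<in> dsum X. row T x = 0}"
    then show "x \<in> defect_op X T ` dsum X" using defect_op_fixed by force
  qed (auto simp: row_defect_op defect_op_in_dsum)
  moreover have "closed {x \<in> dsum X. row T x = 0}"
    unfolding eq by (intro closed_Int closed_csubspaceD(1) dsum_X closed_csubspace_orth)
  ultimately show ?thesis by (simp add: defect_space_def closure_closed)
qed

lemma closed_csubspace_defect_space: "closed_csubspace (defect_space X T)"
proof -
  have "closed (defect_space X T)" by (simp add: defect_space_def)
  then show ?thesis
    using closed_csubspaceD[OF dsum_X] bounded_opD[OF row_op] bounded_op_linear[OF row_op dsum_X]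
    by (auto simp: closed_csubspace_def defect_space_eq)
qed

lemma defect_op_bounded: "bounded_op (dsum X) (defect_space X T) (defect_op X T)"
  and norm_defect_op_le: "x \<in> dsum X \<Longrightarrow> norm (defect_op X T x) \<le> norm x"
proof -
  note R = bounded_opD[OF row_op] bounded_op_linear[OF row_op dsum_X]
  note A = bounded_opD[OF row_adj_op] bounded_op_linear[OF row_adj_op X]
  note D = closed_csubspaceD[OF dsum_X]
  show contr: "norm (defect_op X T x) \<le> norm x" if "x \<in> dsum X" for x
  proof -
    have "cinner (defect_op X T x) (row_adj (row T x)) = 0"
      using cinner_row[OF defect_op_in_dsum] row_defect_op that by simp
    from norm_add_orthogonal[OF this] show ?thesis
      by - (rule power2_le_imp_le, simp_all add: defect_op_eq that)
  qed
  have "defect_op X T (x + y) = defect_op X T x + defect_op X T y"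
    if "x \<in> dsum X" "y \<in> dsum X" for x y
    using that D by (simp add: defect_op_eq) (simp only: R A, simp)
  moreover have "defect_op X T (c *\<^sub>C x) = c *\<^sub>C defect_op X T x" if "x \<in> dsum X" for c x
    using that D by (simp add: defect_op_eq) (simp only: R A scaleC_diff_right)
  ultimately show "bounded_op (dsum X) (defect_space X T) (defect_op X T)"
    using contr unfolding bounded_op_def
    by (auto simp: defect_space_eq defect_op_in_dsum row_defect_op intro!: exI[of _ 1])
qed

lemma sum_defect_comp:
  assumes "x \<in> dsum X"
  shows "(\<Sum>j\<in>UNIV. defect_comp X T j (x $ j)) = defect_op X T x"
proof -
  have "defect_op X T (\<Sum>j\<in>UNIV. axis j (x $ j)) = (\<Sum>j\<in>UNIV. defect_op X T (axis j (x $ j)))"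
    using assms by (intro bounded_op_sum[OF defect_op_bounded dsum_X] axis_in_dsum[OF X])
      (simp add: dsum_def)
  then show ?thesis by (simp add: sum_axis defect_comp_def)
qed

text \<open>On the range of the defect projection, the adjoint of \<open>l \<mapsto> D (axis j l)\<close> is the adjoint of
  \<open>axis j\<close>.\<close>

lemma defect_comp_adj_eq:
  assumes "\<eta> \<in> defect_space X T"
  shows "defect_comp_adj X T j \<eta> = \<eta> $ j"
  unfolding defect_comp_adj_def
proof (rule adj_eqI[OF X])
  from assms have \<eta>: "\<eta> \<in> dsum X" "row T \<eta> = 0" by (auto simp: defect_space_eq)
  then show "\<eta> $ j \<in> X" by (simp add: dsum_def)
  show "cinner (defect_comp X T j u) \<eta> = cinner u (\<eta> $ j)" if "u \<in> X" for u
    using cinner_defect_op[OF axis_in_dsum[OF X that] \<eta>] by (simp add: defect_comp_def cinner_axis_left)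
qed

end

lemma bounded_op_restrict:
  assumes T: "bounded_op UNIV Z T" and X: "closed_csubspace X"
    and eq: "\<And>x. x \<in> X \<Longrightarrow> T x = S x" and "\<And>x. x \<in> X \<Longrightarrow> S x \<in> Y"
  shows "bounded_op X Y S"
proof -
  obtain K where K: "\<And>x. norm (T x) \<le> K * norm x"
    using T unfolding bounded_op_def by auto
  have "norm (S x) \<le> K * norm x" if "x \<in> X" for x
    using K[of x] eq[OF that] by simp
  moreover have "S (x + y) = S x + S y" if "x \<in> X" "y \<in> X" for x y
    using that closed_csubspaceD(3)[OF X that] bounded_opD(2)[OF T] by (simp flip: eq)
  moreover have "S (c *\<^sub>C x) = c *\<^sub>C S x" if "x \<in> X" for c x
    using that closed_csubspaceD(4)[OF X that] bounded_opD(3)[OF T] by (simp flip: eq)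
  ultimately show ?thesis
    using assms(4) unfolding bounded_op_def by blast
qed

lemma bounded_op_word:
  assumes "\<And>j. bounded_op X X (T j)"
  shows "bounded_op X X (word_op T \<alpha>)"
proof (induction \<alpha>)
  case Nil
  show ?case by (auto simp: bounded_op_def intro!: exI[of _ 1])
next
  case (Cons j \<alpha>)
  then show ?case using bounded_op_comp[OF Cons assms] by (simp add: comp_def)
qed

lemma adj_word_op:
  assumes X: "closed_csubspace X" and T: "\<And>j. bounded_op X X (T j)" and "x \<in> X"
  shows "adj X X (word_op T []) x = x"
    "adj X X (word_op T (j # \<alpha>)) x = adj X X (word_op T \<alpha>) (adj X X (T j) x)"
proof -
  show "adj X X (word_op T []) x = x"
    using \<open>x \<in> X\<close> by (intro adj_eqI[OF X]) auto
  note W = bounded_op_word[where T = T, OF T]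
  note w = adj_characterization[OF W X] and t = adj_characterization[OF T X]
  show "adj X X (word_op T (j # \<alpha>)) x = adj X X (word_op T \<alpha>) (adj X X (T j) x)"
  proof (rule adj_eqI[OF X w(1)])
    fix u assume "u \<in> X"
    then show "cinner (word_op T (j # \<alpha>) u) x
        = cinner u (adj X X (word_op T \<alpha>) (adj X X (T j) x))"
      using bounded_opD(1)[OF W] by (simp add: t(2) w(2))
  qed
qed

section \<open>Square summable families indexed by words\<close>

lemma l2_eqI: "(\<And>\<alpha>. coeff f \<alpha> = coeff g \<alpha>) \<Longrightarrow> f = g"
  by (simp add: coeff_inject[symmetric] fun_eq_iff)

lemma coeff_Abs_l2: "(\<lambda>i. (norm (f i))\<^sup>2) summable_on UNIV \<Longrightarrow> coeff (Abs_l2 f) = f"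
  by (simp add: Abs_l2_inverse)

lemma coeff_sum: "coeff (\<Sum>i\<in>I. f i) \<alpha> = (\<Sum>i\<in>I. coeff (f i) \<alpha>)"
  by (induction I rule: infinite_finite_induct) (auto simp: zero_l2.rep_eq plus_l2.rep_eq)

lemma coeff_basis_tensor: "coeff (fock_basis \<beta> \<otimes>\<^sub>F y) \<alpha> = (if \<alpha> = \<beta> then y else 0)"
  by (simp add: coeff_tensor coeff_fock_basis scaleC_0_1)

lemma norm_basis_tensor: "norm (fock_basis \<beta> \<otimes>\<^sub>F y) = norm y"
proof -
  have "cinner (fock_basis \<beta>) (fock_basis \<beta>) = (\<Sum>\<^sub>\<infinity>\<alpha>\<in>{\<beta>}. 1)"
    unfolding cinner_l2_def
    by (rule infsum_cong_neutral) (auto simp: coeff_fock_basis cinner_complex_def)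
  then have "complex_of_real ((norm (fock_basis \<beta> \<otimes>\<^sub>F y))\<^sup>2) = complex_of_real ((norm y)\<^sup>2)"
    by (simp only: cinner_self[symmetric] cinner_tensor) simp
  then have "(norm (fock_basis \<beta> \<otimes>\<^sub>F y))\<^sup>2 = (norm y)\<^sup>2" using of_real_eq_iff by blast
  then show ?thesis by simp
qed

definition restrict_l2 :: "('i, 'v::complex_inner) l2 \<Rightarrow> 'i set \<Rightarrow> ('i, 'v) l2" where
  "restrict_l2 f S = Abs_l2 (\<lambda>i. if i \<in> S then coeff f i else 0)"

lemma coeff_restrict_l2: "coeff (restrict_l2 f S) i = (if i \<in> S then coeff f i else 0)"
proof -
  have "(\<lambda>i. (norm (if i \<in> S then coeff f i else 0))\<^sup>2) summable_on UNIV"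
    by (rule summable_on_comparison_test[OF coeff_summable[of f]]) auto
  then show ?thesis by (simp add: restrict_l2_def coeff_Abs_l2)
qed

lemma tensor_expansion_restrict:
  "((\<lambda>\<alpha>. fock_basis \<alpha> \<otimes>\<^sub>F coeff f \<alpha>) has_sum restrict_l2 f S) S"
proof -
  have "fock_basis \<alpha> \<otimes>\<^sub>F 0 = 0" for \<alpha> :: "'a list"
    by (rule l2_eqI) (simp add: coeff_tensor zero_l2.rep_eq)
  then show ?thesis
    using tensor_expansion[of "restrict_l2 f S"]
    by (subst has_sum_cong_neutral[where T = UNIV and
          g = "\<lambda>\<alpha>. fock_basis \<alpha> \<otimes>\<^sub>F coeff (restrict_l2 f S) \<alpha>"])
      (auto simp: coeff_restrict_l2)
qed

lemma Psi_C_eqI: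
  assumes "\<And>\<alpha>. coeff y \<alpha> = coeff f (rev \<alpha>)"
  shows "Psi_C y = f"
proof -
  have "bij_betw rev (UNIV :: 'a list set) UNIV"
    by (rule bij_betwI[where g = rev]) auto
  from has_sum_reindex_bij_betw[OF this, THEN iffD2, OF tensor_expansion[of f]]
  show ?thesis unfolding Psi_C_def assms by (rule infsumI)
qed

lemma finite_words: "finite {\<alpha> :: 'n::finite list. length \<alpha> < N}"
  by (rule finite_subset[OF _ finite_lists_length_le[OF finite, of UNIV N]]) auto

lemma sum_words_Suc:
  fixes f :: "'n::finite list \<Rightarrow> real"
  shows "(\<Sum>\<alpha> | length \<alpha> < Suc N. f \<alpha>) = f [] + (\<Sum>j\<in>UNIV. \<Sum>\<alpha> | length \<alpha> < N. f (j # \<alpha>))"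
proof -
  have eq: "{\<alpha> :: 'n list. length \<alpha> < Suc N} = insert [] (\<Union>j. (#) j ` {\<alpha>. length \<alpha> < N})"
    by (auto simp: image_iff) (metis length_Cons neq_Nil_conv not_less_eq Suc_less_eq)
  have "(\<Sum>\<alpha> | length \<alpha> < Suc N. f \<alpha>)
      = f [] + sum f (\<Union>j. (#) j ` {\<alpha>. length \<alpha> < N})"
    unfolding eq by (rule sum.insert) (auto intro: finite_words)
  also have "sum f (\<Union>j. (#) j ` {\<alpha>. length \<alpha> < N}) = (\<Sum>j\<in>UNIV. sum f ((#) j ` {\<alpha>. length \<alpha> < N}))"
    by (rule sum.UNION_disjoint) (auto intro: finite_words)
  also have "\<dots> = (\<Sum>j\<in>UNIV. \<Sum>\<alpha> | length \<alpha> < N. f (j # \<alpha>))"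
    by (simp add: sum.reindex)
  finally show ?thesis .
qed

lemma summable_on_words:
  fixes f :: "'n::finite list \<Rightarrow> real"
  assumes "\<And>\<alpha>. f \<alpha> \<ge> 0" and "\<And>N. (\<Sum>\<alpha> | length \<alpha> < N. f \<alpha>) \<le> M"
  shows "f summable_on UNIV" "(\<Sum>\<^sub>\<infinity>\<alpha>. f \<alpha>) \<le> M"
proof -
  have le: "sum f F \<le> M" if "finite F" for F
  proof -
    have "\<exists>N. \<forall>\<alpha>\<in>F. length \<alpha> < N"
      using finite_nat_set_iff_bounded[of "length ` F"] that by auto
    then obtain N where "F \<subseteq> {\<alpha>. length \<alpha> < N}" by blast
    then have "sum f F \<le> (\<Sum>\<alpha> | length \<alpha> < N. f \<alpha>)"
      using assms(1) by (intro sum_mono2 finite_words)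
    also have "\<dots> \<le> M" by (rule assms(2))
    finally show ?thesis .
  qed
  show "f summable_on UNIV"
    using assms(1) le by (intro nonneg_bdd_above_summable_on) (auto intro!: bdd_aboveI2[where M = M])
  then show "(\<Sum>\<^sub>\<infinity>\<alpha>. f \<alpha>) \<le> M"
    by (rule infsum_le_finite_sums) (use le in auto)
qed

section \<open>Coisometric liftings\<close>

locale lifting =
  fixes HC :: "'h::chilbert_space set" and C E A B :: "'n::finite \<Rightarrow> 'h \<Rightarrow> 'h"
  assumes HC: "closed_csubspace HC"
    and coisometric_C: "coisometric HC C"
    and lifting: "coisometric_lifting HC C E A B"
begin

sublocale base: coisometric_tuple HC C
  using HC coisometric_C by unfold_locales

sublocale lift: coisometric_tuple UNIV E
  using lifting by unfold_locales (auto simp: coisometric_lifting_def closed_csubspace_UNIV)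

abbreviation HA :: "'h set" where "HA \<equiv> orth HC"

definition proj_A :: "'h \<Rightarrow> 'h" where "proj_A x = x - proj HC x"

definition B_adj :: "'h \<Rightarrow> 'h ^ 'n" where "B_adj x = (\<chi> j. adj HC HA (B j) x)"

lemma HA: "closed_csubspace HA"
  by (rule closed_csubspace_orth)

lemma proj_simps: "proj HC x \<in> HC" "proj_A x \<in> HA" "proj HC x + proj_A x = x"
  using proj_orth[OF HC, of x] bounded_opD(1)[OF proj_bounded_op[OF HC], of x]
  by (simp_all add: proj_A_def)

lemma proj_decomposition:
  assumes "p \<in> HC" "q \<in> HA"
  shows "proj HC (p + q) = p" "proj_A (p + q) = q"
  using proj_eqI[OF HC assms(1), of "p + q"] assms(2) by (simp_all add: proj_A_def)

lemma proj_HC: "p \<in> HC \<Longrightarrow> proj HC p = p" "p \<in> HC \<Longrightarrow> proj_A p = 0"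
  using proj_decomposition[of p 0] closed_csubspaceD(2)[OF HA] by auto

lemma proj_HA: "q \<in> HA \<Longrightarrow> proj HC q = 0" "q \<in> HA \<Longrightarrow> proj_A q = q"
  using proj_decomposition[of 0 q] closed_csubspaceD(2)[OF HC] by auto

lemma norm_proj_sq: "(norm x)\<^sup>2 = (norm (proj HC x))\<^sup>2 + (norm (proj_A x))\<^sup>2"
  using norm_add_orthogonal[OF cinner_orth(2)[OF proj_simps(1,2)], of x x] by (simp add: proj_simps(3))

lemma proj_A_op: "bounded_op UNIV HA proj_A"
proof -
  note p = bounded_opD[OF proj_bounded_op[OF HC]]
  have "(norm (proj_A x))\<^sup>2 \<le> (norm x)\<^sup>2" for x by (simp add: norm_proj_sq[of x])
  then have "norm (proj_A x) \<le> 1 * norm x" for x by - (rule power2_le_imp_le, simp_all)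
  moreover have "proj_A (x + y) = proj_A x + proj_A y" "proj_A (c *\<^sub>C x) = c *\<^sub>C proj_A x" for x y c
    by (simp_all add: proj_A_def p scaleC_diff_right)
  ultimately show ?thesis
    unfolding bounded_op_def using proj_simps(2) by blast
qed

lemma cinner_decomposition:
  assumes "p \<in> HC" "q \<in> HA" "p' \<in> HC" "q' \<in> HA"
  shows "cinner (p + q) (p' + q') = cinner p p' + cinner q q'"
  using assms by (simp add: cinner_add_left cinner_add_right cinner_orth)

lemma E_on_HC:
  assumes "h \<in> HC"
  shows "C j h \<in> HC" "B j h \<in> HA" "E j h = C j h + B j h"
  using lifting assms by (auto simp: coisometric_lifting_def)

lemma E_on_HA:
  assumes "h \<in> HA"
  shows "A j h \<in> HA" "E j h = A j h"
  using lifting assms by (auto simp: coisometric_lifting_def)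

lemma A_op: "bounded_op HA HA (A j)"
  by (rule bounded_op_restrict[OF lift.op HA]) (simp_all add: E_on_HA)

lemma B_op: "bounded_op HC HA (B j)"
proof (rule bounded_op_restrict[OF _ HC])
  show "bounded_op UNIV HA (proj_A \<circ> E j)"
    using lift.op proj_A_op by (rule bounded_op_comp)
  show "(proj_A \<circ> E j) h = B j h" if "h \<in> HC" for h
    using E_on_HC[OF that] by (simp add: proj_decomposition)
qed (rule E_on_HC)

lemma B_adj_eq: "adj (dsum HC) HA (row B) = B_adj"
  using adj_row[where T = B, OF HC B_op] by (auto simp: B_adj_def)

lemma B_adj_op: "bounded_op Z (dsum HC) B_adj"
  unfolding B_adj_eq[symmetric] by (intro bounded_op_adj bounded_op_row HA B_op base.dsum_X)

lemmas A_adj = adj_characterization[OF A_op HA]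
  and B_j_adj = adj_characterization[OF B_op HC]
  and C_adj = adj_characterization[OF base.op HC]

text \<open>This is the block form of \<open>E\<^sub>j\<^sup>*\<close>: the adjoint of a lower triangular operator is upper
  triangular.\<close>

lemma E_adj:
  "adj UNIV UNIV (E j) x =
    (adj HC HC (C j) (proj HC x) + adj HC HA (B j) (proj_A x)) + adj HA HA (A j) (proj_A x)"
proof (rule adj_eqI[OF closed_csubspace_UNIV])
  fix u
  let ?p = "proj HC u" and ?q = "proj_A u"
  note in_HA = closed_csubspaceD(3)[OF HA] and in_HC = closed_csubspaceD(3)[OF HC]
  have "E j u = E j ?p + E j ?q"
    using bounded_opD(2)[OF lift.op, of ?p ?q j] by (simp add: proj_simps)
  also have "\<dots> = C j ?p + (B j ?p + A j ?q)"
    by (simp add: E_on_HC E_on_HA proj_simps add.assoc)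
  finally have "cinner (E j u) x
      = cinner (C j ?p + (B j ?p + A j ?q)) (proj HC x + proj_A x)"
    by (simp add: proj_simps)
  also have "\<dots> = cinner (C j ?p) (proj HC x) + cinner (B j ?p + A j ?q) (proj_A x)"
    by (intro cinner_decomposition in_HA E_on_HC E_on_HA proj_simps)
  also have "\<dots> = cinner ?p (adj HC HC (C j) (proj HC x) + adj HC HA (B j) (proj_A x))
      + cinner ?q (adj HA HA (A j) (proj_A x))"
    by (simp add: cinner_add_left cinner_add_right A_adj B_j_adj C_adj proj_simps)
  also have "\<dots> = cinner (?p + ?q) ((adj HC HC (C j) (proj HC x) + adj HC HA (B j) (proj_A x))
      + adj HA HA (A j) (proj_A x))"
    by (intro cinner_decomposition[symmetric] in_HC A_adj B_j_adj C_adj proj_simps)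
  finally show "cinner (E j u) x = cinner u ((adj HC HC (C j) (proj HC x)
      + adj HC HA (B j) (proj_A x)) + adj HA HA (A j) (proj_A x))"
    by (simp add: proj_simps)
qed simp

lemma proj_E_adj:
  "proj HC (adj UNIV UNIV (E j) x)
    = adj HC HC (C j) (proj HC x) + adj HC HA (B j) (proj_A x)"
  "proj_A (adj UNIV UNIV (E j) x) = adj HA HA (A j) (proj_A x)"
  unfolding E_adj
  by (intro proj_decomposition closed_csubspaceD(3)[OF HC] A_adj B_j_adj C_adj)+

lemma E_adj_HA:
  assumes "x \<in> HA"
  shows "adj UNIV UNIV (E j) x = adj HC HA (B j) x + adj HA HA (A j) x"
  unfolding E_adj proj_HA[OF assms]
  using bounded_op_linear(1)[OF bounded_op_adj[OF base.op HC] HC] by simp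

text \<open>The upper right entry of \<open>E E\<^sup>* = I\<close> is \<open>C B\<^sup>* = 0\<close>, so the defect projection of \<open>C\<close>
  fixes the range of \<open>B\<^sup>*\<close>.\<close>

lemma B_adj_in_defect_space:
  assumes "x \<in> HA"
  shows "B_adj x \<in> defect_space HC C"
proof -
  let ?a = "\<lambda>j. adj HA HA (A j) x" and ?b = "\<lambda>j. adj HC HA (B j) x"
  have "x = (\<Sum>j\<in>UNIV. E j (?b j + ?a j))"
    using lift.row_adjoints[of x] by (simp add: row_def E_adj_HA assms)
  also have "\<dots> = (\<Sum>j\<in>UNIV. C j (?b j)) + (\<Sum>j\<in>UNIV. B j (?b j) + A j (?a j))"
    by (simp add: bounded_opD(2)[OF lift.op] E_on_HC E_on_HA B_j_adj A_adj sum.distrib add.assoc)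
  finally have x: "x = row C (B_adj x) + (\<Sum>j\<in>UNIV. B j (?b j) + A j (?a j))"
    by (simp add: row_def B_adj_def)
  have "row C (B_adj x) \<in> HC"
    using bounded_opD(1)[OF base.row_op bounded_opD(1)[OF B_adj_op]] by blast
  moreover have "(\<Sum>j\<in>UNIV. B j (?b j) + A j (?a j)) \<in> HA"
    by (intro closed_csubspace_sum[OF HA] closed_csubspaceD(3)[OF HA] E_on_HC E_on_HA B_j_adj A_adj)
  ultimately have "row C (B_adj x) = proj HC x"
    using proj_decomposition(1) x by metis
  then show ?thesis
    using bounded_opD(1)[OF B_adj_op, of x UNIV] by (simp add: base.defect_space_eq proj_HA assms)
qed

text \<open>The lower right entry of \<open>E E\<^sup>* = I\<close> is \<open>B B\<^sup>* + A A\<^sup>* = I\<close>.\<close>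

lemma norm_sq_B_adj_A_adj:
  assumes "x \<in> HA"
  shows "(norm (B_adj x))\<^sup>2 + (\<Sum>j\<in>UNIV. (norm (adj HA HA (A j) x))\<^sup>2) = (norm x)\<^sup>2"
proof -
  have "(norm x)\<^sup>2 = (norm (lift.row_adj x))\<^sup>2" by (simp add: lift.norm_row_adj)
  also have "\<dots> = (\<Sum>j\<in>UNIV. (norm (adj HC HA (B j) x + adj HA HA (A j) x))\<^sup>2)"
    by (simp add: norm_vec_sq E_adj_HA assms)
  also have "\<dots> = (\<Sum>j\<in>UNIV. (norm (adj HC HA (B j) x))\<^sup>2 + (norm (adj HA HA (A j) x))\<^sup>2)"
    by (intro sum.cong refl norm_add_orthogonal cinner_orth(2)[of _ HC] B_j_adj A_adj)
  finally show ?thesis by (simp add: norm_vec_sq B_adj_def sum.distrib)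
qed

text \<open>By \<open>(A\<^sub>j\<^sub>\<beta>)\<^sup>* = (A\<^sub>\<beta>)\<^sup>* A\<^sub>j\<^sup>*\<close>, splitting off the first letter reduces the sum over words
  of length at most \<open>N\<close> starting at \<open>x\<close> to the sums over shorter words starting at the \<open>A\<^sub>j\<^sup>* x\<close>.
  The previous identity then closes the induction.\<close>

lemma sum_B_adj_A_adj_words_le:
  assumes "x \<in> HA"
  shows "(\<Sum>\<alpha> | length \<alpha> < N. (norm (B_adj (adj HA HA (word_op A \<alpha>) x)))\<^sup>2) \<le> (norm x)\<^sup>2"
  using assms
proof (induction N arbitrary: x)
  case (Suc N)
  have "(\<Sum>\<alpha> | length \<alpha> < Suc N. (norm (B_adj (adj HA HA (word_op A \<alpha>) x)))\<^sup>2)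
      = (norm (B_adj x))\<^sup>2 + (\<Sum>j\<in>UNIV. \<Sum>\<alpha> | length \<alpha> < N.
          (norm (B_adj (adj HA HA (word_op A \<alpha>) (adj HA HA (A j) x))))\<^sup>2)"
    unfolding sum_words_Suc adj_word_op[where T = A, OF HA A_op Suc.prems] ..
  also have "\<dots> \<le> (norm (B_adj x))\<^sup>2 + (\<Sum>j\<in>UNIV. (norm (adj HA HA (A j) x))\<^sup>2)"
    by (intro add_left_mono sum_mono Suc.IH A_adj)
  finally show ?case using norm_sq_B_adj_A_adj[OF Suc.prems] by simp
qed simp

section \<open>The symbol of the lifting\<close>

text \<open>The index \<open>\<alpha>\<close> refers to the basis vector \<open>e\<^sub>\<alpha>\<close> of the Fock space.  The coefficient of the
  transfer function at \<open>z\<^sup>\<alpha>\<close> is \<open>symbol_coeff \<eta> (rev \<alpha>)\<close>, because \<open>\<Psi>\<^sub>C\<close> reverses words.\<close>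

definition symbol_coeff :: "'h ^ 'n \<Rightarrow> 'n list \<Rightarrow> 'h ^ 'n" where
  "symbol_coeff \<eta> \<alpha> = (case \<alpha> of
      [] \<Rightarrow> defect_op HC C (\<chi> j. proj HC (\<eta> $ j))
    | j # \<beta> \<Rightarrow> B_adj (adj HA HA (word_op A \<beta>) (proj_A (\<eta> $ j))))"

definition symbol :: "'h ^ 'n \<Rightarrow> ('n list, 'h ^ 'n) l2" where
  "symbol \<eta> = Abs_l2 (symbol_coeff \<eta>)"

lemma proj_vec_in_dsum: "(\<chi> j. proj HC (\<eta> $ j)) \<in> dsum HC"
  by (simp add: dsum_def proj_simps)

lemmas A_word_adj_op = bounded_op_adj[OF bounded_op_word[where T = A, OF A_op] HA]

lemma symbol_coeff_in: "symbol_coeff \<eta> \<alpha> \<in> defect_space HC C"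
proof (cases \<alpha>)
  case Nil
  then show ?thesis
    using bounded_opD(1)[OF base.defect_op_bounded proj_vec_in_dsum] by (simp add: symbol_coeff_def)
next
  case (Cons j \<beta>)
  then show ?thesis
    using B_adj_in_defect_space bounded_opD(1)[OF A_word_adj_op proj_simps(2)]
    by (simp add: symbol_coeff_def)
qed

lemma symbol_coeff_add: "symbol_coeff (\<eta> + \<zeta>) \<alpha> = symbol_coeff \<eta> \<alpha> + symbol_coeff \<zeta> \<alpha>"
  and symbol_coeff_scaleC: "symbol_coeff (c *\<^sub>C \<eta>) \<alpha> = c *\<^sub>C symbol_coeff \<eta> \<alpha>"
proof -
  note p = bounded_opD[OF proj_bounded_op[OF HC]] and q = bounded_opD[OF proj_A_op]
    and D = bounded_opD[OF base.defect_op_bounded] and B = bounded_opD[OF B_adj_op[of UNIV]]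
    and A = bounded_opD[OF A_word_adj_op[of UNIV]]
  have "(\<chi> j. proj HC ((\<eta> + \<zeta>) $ j)) = (\<chi> j. proj HC (\<eta> $ j)) + (\<chi> j. proj HC (\<zeta> $ j))"
    by (simp add: vec_eq_iff p)
  then show "symbol_coeff (\<eta> + \<zeta>) \<alpha> = symbol_coeff \<eta> \<alpha> + symbol_coeff \<zeta> \<alpha>"
    by (cases \<alpha>) (simp_all add: symbol_coeff_def q A B D proj_vec_in_dsum)
  have "(\<chi> j. proj HC ((c *\<^sub>C \<eta>) $ j)) = c *\<^sub>C (\<chi> j. proj HC (\<eta> $ j))"
    by (simp add: vec_eq_iff p scaleC_vec_def)
  then show "symbol_coeff (c *\<^sub>C \<eta>) \<alpha> = c *\<^sub>C symbol_coeff \<eta> \<alpha>"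
    by (cases \<alpha>) (simp_all add: symbol_coeff_def scaleC_vec_def[of c \<eta>] q A B D proj_vec_in_dsum)
qed

text \<open>The empty word contributes at most \<open>\<Sum>\<^sub>j \<parallel>Q \<eta>\<^sub>j\<parallel>\<^sup>2\<close>, and the words starting with \<open>j\<close> contribute
  at most \<open>\<parallel>Q' \<eta>\<^sub>j\<parallel>\<^sup>2\<close>; these add up to \<open>\<parallel>\<eta>\<parallel>\<^sup>2\<close> by Pythagoras.\<close>

lemma symbol_coeff_sum_le: "(\<Sum>\<alpha> | length \<alpha> < N. (norm (symbol_coeff \<eta> \<alpha>))\<^sup>2) \<le> (norm \<eta>)\<^sup>2"
proof (cases N)
  case (Suc M)
  have "norm (symbol_coeff \<eta> []) \<le> norm (\<chi> j. proj HC (\<eta> $ j))"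
    using base.norm_defect_op_le[OF proj_vec_in_dsum] by (simp add: symbol_coeff_def)
  then have "(norm (symbol_coeff \<eta> []))\<^sup>2 \<le> (\<Sum>j\<in>UNIV. (norm (proj HC (\<eta> $ j)))\<^sup>2)"
    using power_mono[of "norm (symbol_coeff \<eta> [])" "norm (\<chi> j. proj HC (\<eta> $ j))" 2]
    by (simp add: norm_vec_sq[of "vec_lambda _"])
  moreover have "(\<Sum>j\<in>UNIV. \<Sum>\<alpha> | length \<alpha> < M. (norm (symbol_coeff \<eta> (j # \<alpha>)))\<^sup>2)
      \<le> (\<Sum>j\<in>UNIV. (norm (proj_A (\<eta> $ j)))\<^sup>2)"
    unfolding symbol_coeff_def list.case by (intro sum_mono sum_B_adj_A_adj_words_le proj_simps)
  ultimately show ?thesis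
    by (simp add: Suc sum_words_Suc norm_vec_sq[of \<eta>] norm_proj_sq[of "\<eta> $ _"] sum.distrib
        del: length_0_conv)
qed simp

lemma symbol_summable: "(\<lambda>\<alpha>. (norm (symbol_coeff \<eta> \<alpha>))\<^sup>2) summable_on UNIV"
  using symbol_coeff_sum_le by (intro summable_on_words(1)) auto

lemma coeff_symbol: "coeff (symbol \<eta>) = symbol_coeff \<eta>"
  by (simp add: symbol_def coeff_Abs_l2 symbol_summable)

lemma symbol_op: "bounded_op X (l2_in (defect_space HC C)) symbol"
proof -
  have "symbol (\<eta> + \<zeta>) = symbol \<eta> + symbol \<zeta>" for \<eta> \<zeta>
    by (rule l2_eqI) (simp add: coeff_symbol plus_l2.rep_eq symbol_coeff_add)
  moreover have "symbol (c *\<^sub>C \<eta>) = c *\<^sub>C symbol \<eta>" for c \<eta>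
    by (rule l2_eqI) (simp add: coeff_symbol scaleC_l2.rep_eq symbol_coeff_scaleC)
  moreover have "norm (symbol \<eta>) \<le> 1 * norm \<eta>" for \<eta>
  proof -
    have "(norm (symbol \<eta>))\<^sup>2 \<le> (norm \<eta>)\<^sup>2"
      unfolding norm_l2_sq coeff_symbol
      using symbol_coeff_sum_le by (intro summable_on_words(2)) auto
    then show ?thesis by - (rule power2_le_imp_le, simp_all)
  qed
  ultimately show ?thesis
    unfolding bounded_op_def l2_in_def by (auto simp: coeff_symbol symbol_coeff_in intro!: exI[of _ 1])
qed

section \<open>The transfer function\<close>

text \<open>The vector \<open>Q E\<^sup>* x\<close> is the sum of \<open>C\<^sup>* Q x\<close> and \<open>B\<^sup>* Q' x\<close>.  The defect projection of \<open>C\<close>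
  annihilates the first summand, as \<open>C C\<^sup>* = I\<close>, and fixes the second one.\<close>

lemma defect_op_proj_E_adj:
  "defect_op HC C (\<chi> j. proj HC (adj UNIV UNIV (E j) x)) = B_adj (proj_A x)"
proof -
  have eq: "(\<chi> j. proj HC (adj UNIV UNIV (E j) x)) = base.row_adj (proj HC x) + B_adj (proj_A x)"
    by (simp add: vec_eq_iff proj_E_adj B_adj_def)
  have B: "B_adj (proj_A x) \<in> dsum HC" "row C (B_adj (proj_A x)) = 0"
    using B_adj_in_defect_space[OF proj_simps(2)] by (auto simp: base.defect_space_eq)
  have "defect_op HC C (base.row_adj (proj HC x) + B_adj (proj_A x))
      = defect_op HC C (base.row_adj (proj HC x)) + defect_op HC C (B_adj (proj_A x))"
    by (intro bounded_opD(2)[OF base.defect_op_bounded] B bounded_opD(1)[OF base.row_adj_op] proj_simps)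
  then show ?thesis
    unfolding eq by (simp add: base.defect_op_row_adj proj_simps base.defect_op_fixed B)
qed

lemma tilde_C_eq: "tilde_C HC C E x = B_adj (proj_A x)"
  using base.sum_defect_comp[of "\<chi> j. proj HC (adj UNIV UNIV (E j) x)"]
  by (simp add: tilde_C_def dsum_def proj_simps defect_op_proj_E_adj)

lemma tilde_D_eq:
  assumes "\<eta> \<in> defect_space UNIV E"
  shows "tilde_D HC C E \<eta> = defect_op HC C (\<chi> j. proj HC (\<eta> $ j))"
  using base.sum_defect_comp[OF proj_vec_in_dsum[of \<eta>]]
  by (simp add: tilde_D_def lift.defect_comp_adj_eq[OF assms])

lemma proj_A_word_adj:
  "proj_A (adj UNIV UNIV (word_op E \<alpha>) x) = adj HA HA (word_op A \<alpha>) (proj_A x)"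
proof (induction \<alpha> arbitrary: x)
  case Nil
  show ?case
    by (simp only: adj_word_op(1)[OF closed_csubspace_UNIV lift.op UNIV_I]
        adj_word_op(1)[OF HA A_op proj_simps(2)])
next
  case (Cons j \<alpha>)
  show ?case
    by (simp only: adj_word_op(2)[OF closed_csubspace_UNIV lift.op UNIV_I]
        adj_word_op(2)[OF HA A_op proj_simps(2)] Cons.IH proj_E_adj)
qed

text \<open>The word \<open>\<beta>\<close> enters the transfer function as \<open>(E\<^sub>\<beta>)\<^sup>*\<close> with \<open>\<beta>\<close> reversed, at the power
  \<open>z\<^sup>\<beta>\<^sup>j\<close>; reversing \<open>\<beta>j\<close> puts \<open>j\<close> first, as in the symbol.\<close>

lemma transfer_function_eq:
  assumes "\<eta> \<in> defect_space UNIV E"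
  shows "transfer_function HC C E \<alpha> \<eta> = symbol_coeff \<eta> (rev \<alpha>)"
proof (cases \<alpha> rule: rev_cases)
  case Nil
  then show ?thesis by (simp add: transfer_function_def symbol_coeff_def tilde_D_eq[OF assms])
next
  case (snoc \<beta> j)
  then have "{(\<beta>', j'). \<beta>' @ [j'] = \<alpha>} = {(\<beta>, j)}" by auto
  then show ?thesis
    by (simp add: transfer_function_def symbol_coeff_def snoc tilde_C_eq proj_A_word_adj
        lift.defect_comp_adj_eq[OF assms])
qed

text \<open>Multiplication by a constant series is coefficientwise application, since only the
  factorisation \<open>\<alpha> = \<alpha> \<emptyset>\<close> contributes; the transfer function must map \<open>0\<close> to \<open>0\<close> for this.\<close>

lemma series_mult_const:
  assumes "\<eta> \<in> defect_space UNIV E"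
  shows "coeff (series_mult (transfer_function HC C E) (const_series \<eta>)) \<alpha> = coeff (symbol \<eta>) (rev \<alpha>)"
proof -
  have zero: "transfer_function HC C E \<beta> 0 = 0" for \<beta>
    using symbol_coeff_scaleC[of 0 0 "rev \<beta>"]
      closed_csubspaceD(2)[OF lift.closed_csubspace_defect_space]
    by (simp add: transfer_function_eq scaleC_0_1)
  have "(\<Sum>(\<beta>, \<beta>')\<in>{(\<beta>, \<beta>'). \<beta> @ \<beta>' = \<alpha>}. transfer_function HC C E \<beta> (coeff (const_series \<eta>) \<beta>'))
      = (\<Sum>(\<beta>, \<beta>')\<in>{(\<alpha>, [] :: 'n list)}. transfer_function HC C E \<beta> (coeff (const_series \<eta>) \<beta>'))"
    for \<alpha> :: "'n list"
  proof (rule sum.mono_neutral_right)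
    have "{(\<beta>, \<beta>'). \<beta> @ \<beta>' = \<alpha>} \<subseteq> (\<lambda>k. (take k \<alpha>, drop k \<alpha>)) ` {..length \<alpha>}"
    proof clarify
      fix \<beta> \<beta>' :: "'n list"
      show "(\<beta>, \<beta>') \<in> (\<lambda>k. (take k (\<beta> @ \<beta>'), drop k (\<beta> @ \<beta>'))) ` {..length (\<beta> @ \<beta>')}"
        by (rule image_eqI[where x = "length \<beta>"]) auto
    qed
    then show "finite {(\<beta>, \<beta>'). \<beta> @ \<beta>' = \<alpha>}" by (rule finite_subset) simp
  qed (auto simp: coeff_const_series zero split: if_splits)
  then have "series_mult (transfer_function HC C E) (const_series \<eta>)
      = Abs_l2 (\<lambda>\<alpha>. symbol_coeff \<eta> (rev \<alpha>))"
    by (simp add: series_mult_def coeff_const_series transfer_function_eq[OF assms])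
  moreover have "(\<lambda>\<alpha>. (norm (symbol_coeff \<eta> (rev \<alpha>)))\<^sup>2) summable_on UNIV"
  proof -
    have "bij_betw rev (UNIV :: 'n list set) UNIV"
      by (rule bij_betwI[where g = rev]) auto
    from summable_on_reindex_bij_betw[OF this, THEN iffD2, OF symbol_summable]
    show ?thesis .
  qed
  ultimately show ?thesis by (simp add: coeff_Abs_l2 coeff_symbol)
qed

lemma Psi_C_transfer_function:
  assumes "\<eta> \<in> defect_space UNIV E"
  shows "Psi_C (series_mult (transfer_function HC C E) (const_series \<eta>)) = symbol \<eta>"
  by (rule Psi_C_eqI) (rule series_mult_const[OF assms])

section \<open>Identification with the characteristic function\<close>

lemma defect_comp_E_nth:
  "defect_comp UNIV E i h $ j = (if i = j then h else 0) - adj UNIV UNIV (E j) (E i h)"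
proof -
  have "row E (axis i h) = (\<Sum>j\<in>UNIV. if j = i then E j h else 0)"
    unfolding row_def by (intro sum.cong) (auto simp: axis_def bounded_op_linear[OF lift.op closed_csubspace_UNIV])
  then show ?thesis
    by (simp add: defect_comp_def lift.defect_op_eq dsum_def axis_def)
qed

lemma defect_comp_E_in: "defect_comp UNIV E i h \<in> defect_space UNIV E"
  using bounded_opD(1)[OF lift.defect_op_bounded] by (simp add: defect_comp_def dsum_def)

text \<open>Keeping \<open>h\<close> general here treats \<open>\<H>\<^sub>C\<close> and \<open>\<H>\<^sub>A\<close> at once; the two expansions of the
  characteristic function are the cases \<open>Q h = h\<close> and \<open>Q h = 0\<close>.\<close>

lemma symbol_coeff_defect_comp:
  "symbol_coeff (defect_comp UNIV E i h) []
    = defect_comp HC C i (proj HC h) - B_adj (proj_A (E i h))" (is ?empty)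
  "symbol_coeff (defect_comp UNIV E i h) (j # \<alpha>) = B_adj (adj HA HA (word_op A \<alpha>)
      ((if i = j then proj_A h else 0) - adj HA HA (A j) (proj_A (E i h))))" (is ?Cons)
proof -
  note p = bounded_op_linear[OF proj_bounded_op[OF HC] closed_csubspace_UNIV]
    and q = bounded_op_linear[OF proj_A_op closed_csubspace_UNIV]
  have "(\<chi> j. proj HC (defect_comp UNIV E i h $ j))
      = axis i (proj HC h) - (\<chi> j. proj HC (adj UNIV UNIV (E j) (E i h)))"
    by (simp add: vec_eq_iff defect_comp_E_nth p axis_def)
  moreover have "(\<chi> j. proj HC (adj UNIV UNIV (E j) (E i h))) \<in> dsum HC"
    by (simp add: dsum_def proj_simps)
  ultimately show ?empty
    using bounded_op_linear(3)[OF base.defect_op_bounded base.dsum_X, of "axis i (proj HC h)"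
        "\<chi> j. proj HC (adj UNIV UNIV (E j) (E i h))"]
    by (simp add: symbol_coeff_def axis_in_dsum[OF HC] proj_simps
        defect_op_proj_E_adj defect_comp_def)
  show ?Cons
    by (simp add: symbol_coeff_def defect_comp_E_nth q proj_E_adj)
qed

text \<open>For \<open>h\<close> in \<open>\<H>\<^sub>C\<close> the factor \<open>A\<^sub>j\<^sup>*\<close> in the coefficient at \<open>j\<alpha>\<close> is absorbed into the word:
  \<open>(A\<^sub>\<alpha>)\<^sup>* A\<^sub>j\<^sup>* B\<^sub>i h = (A\<^sub>j\<^sub>\<alpha>)\<^sup>* B\<^sub>i h\<close>.\<close>

lemma symbol_defect_comp_HC:
  assumes \<gamma>: "\<And>x. x \<in> HA \<Longrightarrow> \<gamma> (star_defect_op HA A x) = B_adj x" and h: "h \<in> HC"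
  shows "\<exists>S. ((\<lambda>\<alpha>. fock_basis \<alpha> \<otimes>\<^sub>F
            \<gamma> (star_defect_op HA A (adj HA HA (word_op A \<alpha>) (B i h)))) has_sum S) {\<alpha>. length \<alpha> \<ge> 1} \<and>
      symbol (defect_comp UNIV E i h) =
        fock_basis [] \<otimes>\<^sub>F (defect_comp HC C i h - \<gamma> (star_defect_op HA A (B i h))) - S"
proof -
  let ?f = "symbol (defect_comp UNIV E i h)"
  let ?W = "{\<alpha> :: 'n list. length \<alpha> \<ge> 1}"
  note in_HA = bounded_opD(1)[OF A_word_adj_op UNIV_I]
  have P: "proj_A (E i h) = B i h"
    by (simp add: E_on_HC[OF h] proj_decomposition)
  have coeff_Cons: "coeff ?f (j # \<alpha>) = - B_adj (adj HA HA (word_op A (j # \<alpha>)) (B i h))" for j \<alpha>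
    using bounded_op_linear(2)[OF A_word_adj_op HA A_adj(1)]
      bounded_op_linear(2)[OF B_adj_op HA in_HA]
      closed_csubspaceD(5)[OF HA A_adj(1)] bounded_op_linear(3)[OF A_word_adj_op HA]
    by (simp add: coeff_symbol symbol_coeff_defect_comp P proj_HC h
        adj_word_op(2)[where T = A, OF HA A_op E_on_HC(2)[OF h]] del: word_op.simps)
  have coeff_f: "\<gamma> (star_defect_op HA A (adj HA HA (word_op A \<alpha>) (B i h))) = - coeff ?f \<alpha>"
    if "\<alpha> \<in> ?W" for \<alpha>
    using that by (cases \<alpha>) (simp_all add: coeff_Cons \<gamma>[OF in_HA] del: word_op.simps)
  have "fock_basis \<alpha> \<otimes>\<^sub>F - y = - (fock_basis \<alpha> \<otimes>\<^sub>F y)" for \<alpha> :: "'n list" and y :: "'h ^ 'n"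
    by (rule l2_eqI) (simp add: coeff_basis_tensor uminus_l2.rep_eq)
  then have "((\<lambda>\<alpha>. fock_basis \<alpha> \<otimes>\<^sub>F
      \<gamma> (star_defect_op HA A (adj HA HA (word_op A \<alpha>) (B i h)))) has_sum - restrict_l2 ?f ?W) ?W"
    using tensor_expansion_restrict[of ?f ?W]
    by (subst has_sum_cong[where g = "\<lambda>\<alpha>. - (fock_basis \<alpha> \<otimes>\<^sub>F coeff ?f \<alpha>)"])
      (simp_all add: coeff_f has_sum_uminus)
  moreover have "?f = fock_basis [] \<otimes>\<^sub>F (defect_comp HC C i h - \<gamma> (star_defect_op HA A (B i h)))
      - - restrict_l2 ?f ?W"
  proof (rule l2_eqI)
    show "coeff ?f \<alpha> = coeff (fock_basis [] \<otimes>\<^sub>F (defect_comp HC C i h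
        - \<gamma> (star_defect_op HA A (B i h))) - - restrict_l2 ?f ?W) \<alpha>" for \<alpha>
      by (cases \<alpha>) (simp_all add: coeff_minus plus_l2.rep_eq uminus_l2.rep_eq coeff_restrict_l2
          coeff_basis_tensor coeff_symbol symbol_coeff_defect_comp(1) P \<gamma> E_on_HC(2)[OF h] proj_HC(1)[OF h])
  qed
  ultimately show ?thesis by blast
qed

text \<open>For \<open>h\<close> in \<open>\<H>\<^sub>A\<close> the coefficients are summed separately for each first letter \<open>j\<close>, that is,
  over the words in \<open>range ((#) j)\<close>.\<close>

lemma symbol_defect_comp_HA:
  assumes \<gamma>: "\<And>x. x \<in> HA \<Longrightarrow> \<gamma> (star_defect_op HA A x) = B_adj x" and h: "h \<in> HA"
  shows "\<exists>S. (\<forall>j. ((\<lambda>\<alpha>. fock_basis (j # \<alpha>) \<otimes>\<^sub>F \<gamma> (star_defect_op HA A (adj HA HA (word_op A \<alpha>)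
            ((if i = j then h else 0) - adj HA HA (A j) (A i h))))) has_sum S j) UNIV) \<and>
      symbol (defect_comp UNIV E i h) =
        - (fock_basis [] \<otimes>\<^sub>F \<gamma> (star_defect_op HA A (A i h))) + (\<Sum>j\<in>UNIV. S j)"
proof -
  let ?f = "symbol (defect_comp UNIV E i h)"
  define S where "S j = restrict_l2 ?f (range ((#) j))" for j
  note in_HA = bounded_opD(1)[OF A_word_adj_op UNIV_I]
  have P: "proj_A (E i h) = A i h"
    by (simp add: E_on_HA[OF h] proj_HA)
  have \<gamma>_eq: "\<gamma> (star_defect_op HA A (adj HA HA (word_op A \<alpha>)
      ((if i = j then h else 0) - adj HA HA (A j) (A i h)))) = coeff ?f (j # \<alpha>)" for j \<alpha>
  proof -
    have "(if i = j then h else 0) - adj HA HA (A j) (A i h) \<in> HA"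
      using h by (auto intro: closed_csubspaceD[OF HA] A_adj(1))
    then show ?thesis
      by (simp only: \<gamma>[OF in_HA] coeff_symbol symbol_coeff_defect_comp(2) P proj_HA(2)[OF h])
  qed
  have "((\<lambda>\<alpha>. fock_basis (j # \<alpha>) \<otimes>\<^sub>F coeff ?f (j # \<alpha>)) has_sum S j) UNIV" for j
    using tensor_expansion_restrict[of ?f "range ((#) j)"]
    by (simp add: has_sum_reindex o_def S_def)
  moreover have "?f = - (fock_basis [] \<otimes>\<^sub>F \<gamma> (star_defect_op HA A (A i h))) + (\<Sum>j\<in>UNIV. S j)"
  proof (rule l2_eqI)
    fix \<alpha>
    show "coeff ?f \<alpha> = coeff (- (fock_basis [] \<otimes>\<^sub>F \<gamma> (star_defect_op HA A (A i h))) + (\<Sum>j\<in>UNIV. S j)) \<alpha>"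
    proof (cases \<alpha>)
      case Nil
      have "defect_comp HC C i 0 = 0"
        using bounded_op_linear(1)[OF base.defect_op_bounded base.dsum_X]
        by (simp add: defect_comp_def axis_def vec_eq_iff zero_vec_def)
      moreover have "[] \<notin> range ((#) j)" for j :: 'n by auto
      ultimately show ?thesis
        by (simp add: Nil coeff_minus uminus_l2.rep_eq coeff_sum S_def coeff_restrict_l2
            coeff_basis_tensor coeff_symbol symbol_coeff_defect_comp(1) P \<gamma> E_on_HA(1)[OF h]
            proj_HA(1)[OF h])
    next
      case (Cons k \<beta>)
      have "(\<Sum>j\<in>UNIV. coeff (S j) (k # \<beta>)) = (\<Sum>j\<in>UNIV. if j = k then coeff ?f (k # \<beta>) else 0)"
        by (intro sum.cong) (auto simp: S_def coeff_restrict_l2)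
      then show ?thesis
        by (simp add: Cons coeff_minus uminus_l2.rep_eq coeff_sum coeff_basis_tensor)
    qed
  qed
  ultimately show ?thesis unfolding \<gamma>_eq by blast
qed

lemma bounded_op_basis_tensor:
  "bounded_op X ((\<otimes>\<^sub>F) (fock_basis []) ` X) ((\<otimes>\<^sub>F) (fock_basis []))"
proof -
  have "fock_basis [] \<otimes>\<^sub>F (x + y) = fock_basis [] \<otimes>\<^sub>F x + fock_basis [] \<otimes>\<^sub>F y" for x y
    by (rule l2_eqI) (simp add: coeff_basis_tensor plus_l2.rep_eq)
  moreover have "fock_basis [] \<otimes>\<^sub>F (c *\<^sub>C y) = c *\<^sub>C (fock_basis [] \<otimes>\<^sub>F y)" for c y
    by (rule l2_eqI) (simp add: coeff_basis_tensor scaleC_l2.rep_eq)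
  ultimately show ?thesis
    unfolding bounded_op_def by (auto simp: norm_basis_tensor intro!: exI[of _ 1])
qed

text \<open>The vectors \<open>(D\<^sub>E)\<^sub>i h\<close> with \<open>h\<close> in \<open>\<H>\<^sub>C\<close> or in \<open>\<H>\<^sub>A\<close> span \<open>\<D>\<^sub>E\<close>: the range of the projection
  \<open>D\<^sub>E\<close> is already closed.\<close>

lemma bounded_op_eq_on_defect_space:
  assumes F: "bounded_op (defect_space UNIV E) Y F" and G: "bounded_op (defect_space UNIV E) Z G"
    and eq: "\<And>i h. h \<in> HC \<union> HA \<Longrightarrow> F (defect_comp UNIV E i h) = G (defect_comp UNIV E i h)"
    and \<eta>: "\<eta> \<in> defect_space UNIV E"
  shows "F \<eta> = G \<eta>"
proof -
  note D = lift.closed_csubspace_defect_space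
  have split: "defect_comp UNIV E j h
      = defect_comp UNIV E j (proj HC h) + defect_comp UNIV E j (proj_A h)" for j h
  proof -
    have "axis j h = axis j (proj HC h) + axis j (proj_A h)"
      by (simp add: vec_eq_iff axis_def proj_simps)
    then show ?thesis
      using bounded_opD(2)[OF lift.defect_op_bounded, of "axis j (proj HC h)" "axis j (proj_A h)"]
      by (simp add: defect_comp_def dsum_def)
  qed
  have "F (defect_comp UNIV E j h) = G (defect_comp UNIV E j h)" for j h
    unfolding split[of j h] using eq[of "proj HC h" j] eq[of "proj_A h" j]
    by (simp add: bounded_opD(2)[OF F] bounded_opD(2)[OF G] defect_comp_E_in proj_simps)
  moreover have "\<eta> = (\<Sum>j\<in>UNIV. defect_comp UNIV E j (\<eta> $ j))"
    using \<eta> lift.sum_defect_comp[of \<eta>] by (simp add: lift.defect_space_eq lift.defect_op_fixed)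
  ultimately show ?thesis
    using bounded_op_sum[OF F D, of UNIV "\<lambda>j. defect_comp UNIV E j (\<eta> $ j)"]
      bounded_op_sum[OF G D, of UNIV "\<lambda>j. defect_comp UNIV E j (\<eta> $ j)"]
    by (simp add: defect_comp_E_in)
qed

text \<open>The operator \<open>e\<^sub>\<emptyset> \<otimes> \<eta> \<mapsto> symbol \<eta>\<close>, extended by \<open>0\<close>, has all properties of the symbol of the
  characteristic function.  Any other operator with these properties agrees with it on the
  vectors \<open>(D\<^sub>E)\<^sub>i h\<close>, because the expansions have unique sums, and thus everywhere.\<close>

lemma char_function_eq:
  assumes "lifting_isometry HC C A B \<gamma>" and "\<eta> \<in> defect_space UNIV E"
  shows "char_function HC C E A B \<gamma> (fock_basis [] \<otimes>\<^sub>F \<eta>) = symbol \<eta>"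
proof -
  let ?X = "(\<otimes>\<^sub>F) (fock_basis []) ` defect_space UNIV E :: ('n list, 'h ^ 'n) l2 set"
  have \<gamma>: "\<gamma> (star_defect_op HA A x) = B_adj x" if "x \<in> HA" for x
    using assms that by (simp add: lifting_isometry_def B_adj_eq)
  note exp_HC = symbol_defect_comp_HC[of \<gamma>, OF \<gamma>] and exp_HA = symbol_defect_comp_HA[of \<gamma>, OF \<gamma>]
  define \<Theta> where "\<Theta> g = (if g \<in> ?X then symbol (coeff g []) else 0)" for g
  have \<Theta>: "\<Theta> (fock_basis [] \<otimes>\<^sub>F \<eta>) = symbol \<eta>" if "\<eta> \<in> defect_space UNIV E" for \<eta>
    using that by (simp add: \<Theta>_def coeff_basis_tensor)
  note V = bounded_opD[OF bounded_op_basis_tensor[of "defect_space UNIV E"]]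
    and S = bounded_opD[OF symbol_op[of "defect_space UNIV E"]]
    and D = closed_csubspaceD[OF lift.closed_csubspace_defect_space]
  have "bounded_op ?X (l2_in (defect_space HC C)) \<Theta>"
  proof -
    obtain K where "\<forall>\<eta>\<in>defect_space UNIV E. norm (symbol \<eta>) \<le> K * norm \<eta>"
      using symbol_op[of "defect_space UNIV E"] unfolding bounded_op_def by blast
    then show ?thesis
      unfolding bounded_op_def
      by (auto simp: \<Theta> V(2,3)[symmetric] S D norm_basis_tensor intro!: exI[of _ K])
  qed
  then have symbol: "is_char_symbol HC C E A B \<gamma> \<Theta>"
    unfolding is_char_symbol_def \<Theta>[OF defect_comp_E_in]
    using exp_HC exp_HA by (intro conjI allI ballI impI) (auto simp: \<Theta>_def)
  have "char_function HC C E A B \<gamma> = \<Theta>"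
    unfolding char_function_def
  proof (rule the_equality[of "is_char_symbol HC C E A B \<gamma>", OF symbol])
    fix \<Theta>' assume *: "is_char_symbol HC C E A B \<gamma> \<Theta>'"
    have comp: "\<Theta>' (fock_basis [] \<otimes>\<^sub>F defect_comp UNIV E i h) = symbol (defect_comp UNIV E i h)"
      if "h \<in> HC \<union> HA" for i h
      using that
    proof
      assume h: "h \<in> HC"
      obtain S where S: "((\<lambda>\<alpha>. fock_basis \<alpha> \<otimes>\<^sub>F \<gamma> (star_defect_op HA A
          (adj HA HA (word_op A \<alpha>) (B i h)))) has_sum S) {\<alpha>. length \<alpha> \<ge> 1}"
          "symbol (defect_comp UNIV E i h)
            = fock_basis [] \<otimes>\<^sub>F (defect_comp HC C i h - \<gamma> (star_defect_op HA A (B i h))) - S"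
        using exp_HC[OF _ h, of i] by blast
      obtain S' where S': "((\<lambda>\<alpha>. fock_basis \<alpha> \<otimes>\<^sub>F \<gamma> (star_defect_op HA A
          (adj HA HA (word_op A \<alpha>) (B i h)))) has_sum S') {\<alpha>. length \<alpha> \<ge> 1}"
          "\<Theta>' (fock_basis [] \<otimes>\<^sub>F defect_comp UNIV E i h)
            = fock_basis [] \<otimes>\<^sub>F (defect_comp HC C i h - \<gamma> (star_defect_op HA A (B i h))) - S'"
        using * h unfolding is_char_symbol_def by blast
      show ?thesis using has_sum_unique[OF S(1) S'(1)] S(2) S'(2) by simp
    next
      assume h: "h \<in> HA"
      obtain S where S: "\<And>j. ((\<lambda>\<alpha>. fock_basis (j # \<alpha>) \<otimes>\<^sub>F \<gamma> (star_defect_op HA A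
          (adj HA HA (word_op A \<alpha>) ((if i = j then h else 0) - adj HA HA (A j) (A i h))))) has_sum S j) UNIV"
          "symbol (defect_comp UNIV E i h)
            = - (fock_basis [] \<otimes>\<^sub>F \<gamma> (star_defect_op HA A (A i h))) + (\<Sum>j\<in>UNIV. S j)"
        using exp_HA[OF _ h, of i] by blast
      obtain S' where S': "\<And>j. ((\<lambda>\<alpha>. fock_basis (j # \<alpha>) \<otimes>\<^sub>F \<gamma> (star_defect_op HA A
          (adj HA HA (word_op A \<alpha>) ((if i = j then h else 0) - adj HA HA (A j) (A i h))))) has_sum S' j) UNIV"
          "\<Theta>' (fock_basis [] \<otimes>\<^sub>F defect_comp UNIV E i h)
            = - (fock_basis [] \<otimes>\<^sub>F \<gamma> (star_defect_op HA A (A i h))) + (\<Sum>j\<in>UNIV. S' j)"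
        using * h unfolding is_char_symbol_def by blast
      have "S j = S' j" for j using has_sum_unique[OF S(1) S'(1)] .
      then show ?thesis using S(2) S'(2) by simp
    qed
    \<comment> \<open>Both operators are compared on \<open>\<D>\<^sub>E\<close>, after composition with \<open>\<eta> \<mapsto> e\<^sub>\<emptyset> \<otimes> \<eta>\<close>.\<close>
    have "bounded_op (defect_space UNIV E) (l2_in (defect_space HC C)) (\<Theta>' \<circ> (\<otimes>\<^sub>F) (fock_basis []))"
      using bounded_op_basis_tensor * unfolding is_char_symbol_def by (auto intro: bounded_op_comp)
    then have "(\<Theta>' \<circ> (\<otimes>\<^sub>F) (fock_basis [])) \<eta> = symbol \<eta>" if "\<eta> \<in> defect_space UNIV E" for \<eta>
      by (rule bounded_op_eq_on_defect_space[OF _ symbol_op _ that]) (simp_all add: comp)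
    then show "\<Theta>' = \<Theta>"
      using * unfolding is_char_symbol_def by (auto simp: fun_eq_iff \<Theta>_def coeff_basis_tensor)
  qed
  then show ?thesis using \<Theta>[OF assms(2)] by simp
qed

end

theorem theorem3p4:
  fixes HC :: "'h::chilbert_space set"
    and C E A B :: "'n::finite \<Rightarrow> 'h \<Rightarrow> 'h"
    and \<gamma> :: "'h \<Rightarrow> 'h ^ 'n"
  assumes "closed_csubspace HC"
    and "coisometric HC C"
    and "coisometric_lifting HC C E A B"
    and "lifting_isometry HC C A B \<gamma>"
  shows "\<forall>\<eta>\<in>defect_space UNIV E.
    Psi_C (series_mult (transfer_function HC C E) (const_series \<eta>)) =
      char_function HC C E A B \<gamma> (Psi_E (const_series \<eta>))"
proof -
  interpret lifting HC C E A B
    using assms(1-3) by unfold_locales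
  show ?thesis
    using assms(4)
    by (simp add: Psi_C_transfer_function char_function_eq Psi_E_def coeff_const_series)
qed

end
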